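(* Let $V=\mathrm{Sym}^2\big((\mathbb R^3)^*\big)\cong\mathbb R^6$ be the vector space of quadratic forms on $\mathbb R^3$, let $\mathbb PV\cong\mathbb{RP}^5$ be its projectivisation, and let $\phi\colon\mathrm{PSL}(3,\mathbb R)\to\mathrm{PGL}(V)$ be the representation sending a projective transformation of $\mathbb{RP}^2$ to the induced projectivity of the space of conics $\mathbb PV$. A subgroup $\Gamma<\mathrm{PSL}(3,\mathbb R)$ is non-elementary if and only if the action of $\phi(\Gamma)$ on $\mathbb PV$ is strongly irreducible.
   Context: A subgroup $\Gamma<\mathrm{PSL}(3,\mathbb R)$ is elementary if, up to passing to a finite-index subgroup, it stabilises a (possibly degenerate, possibly without real points) conic in $\mathbb{RP}^2$ or in the dual plane $(\mathbb{RP}^2)^*$; equivalently, if some finite-index subgroup of $\Gamma$ fixes a point of $\mathbb P\,\mathrm{Sym}^2\big((\mathbb R^3)^*\big)$ or a point of $\mathbb P\,\mathrm{Sym}^2(\mathbb R^3)$ for the induced action. Otherwise $\Gamma$ is non-elementary. The action of $\phi(\Gamma)$ on $\mathbb PV$ is strongly irreducible if there is no non-empty finite $\phi(\Gamma)$-invariant collection of proper (non-empty) projective subspaces; equivalently, if every finite-index subgroup acts irreducibly. *)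

theory Defs
  imports "HOL-Analysis.Analysis" "HOL-Algebra.Coset"
begin

section \<open>Quadratic forms\<close>

typedef (overloaded) 'a quadratic_form =
  "{q :: 'a::real_vector \<Rightarrow> real. \<exists>B. bilinear B \<and> q = (\<lambda>x. B x x)}"
  morphisms form_at Abs_quadratic_form
  by (rule exI[of _ "\<lambda>_. 0"]) (auto intro!: exI[of _ "\<lambda>_ _. 0"] simp: bilinear_def linear_iff)

setup_lifting type_definition_quadratic_form

instantiation quadratic_form :: (real_vector) real_vector
begin

lift_definition zero_quadratic_form :: "'a quadratic_form" is "\<lambda>_. 0"
  by (auto intro!: exI[of _ "\<lambda>_ _. 0"] simp: bilinear_def linear_iff)

lift_definition plus_quadratic_form :: "'a quadratic_form \<Rightarrow> 'a quadratic_form \<Rightarrow> 'a quadratic_form"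
  is "\<lambda>p q x. p x + q x"
proof -
  fix p q :: "'a \<Rightarrow> real"
  assume "\<exists>B. bilinear B \<and> p = (\<lambda>x. B x x)" "\<exists>B. bilinear B \<and> q = (\<lambda>x. B x x)"
  then obtain B C where "bilinear B" "p = (\<lambda>x. B x x)" "bilinear C" "q = (\<lambda>x. C x x)"
    by blast
  then show "\<exists>D. bilinear D \<and> (\<lambda>x. p x + q x) = (\<lambda>x. D x x)"
    by (intro exI[of _ "\<lambda>x y. B x y + C x y"]) (auto simp: bilinear_def linear_iff algebra_simps)
qed

lift_definition scaleR_quadratic_form :: "real \<Rightarrow> 'a quadratic_form \<Rightarrow> 'a quadratic_form"
  is "\<lambda>c q x. c * q x"
proof -
  fix c :: real and q :: "'a \<Rightarrow> real"
  assume "\<exists>B. bilinear B \<and> q = (\<lambda>x. B x x)"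
  then obtain B where "bilinear B" "q = (\<lambda>x. B x x)"
    by blast
  then show "\<exists>D. bilinear D \<and> (\<lambda>x. c * q x) = (\<lambda>x. D x x)"
    by (intro exI[of _ "\<lambda>x y. c * B x y"]) (auto simp: bilinear_def linear_iff algebra_simps)
qed

definition uminus_quadratic_form :: "'a quadratic_form \<Rightarrow> 'a quadratic_form" where
  "- q = (-1) *\<^sub>R (q :: 'a quadratic_form)"

definition minus_quadratic_form :: "'a quadratic_form \<Rightarrow> 'a quadratic_form \<Rightarrow> 'a quadratic_form" where
  "p - q = p + - (q :: 'a quadratic_form)"

instance
  by standard
    ((simp only: uminus_quadratic_form_def minus_quadratic_form_def)?, transfer, simp add: algebra_simps)+

end

text \<open>
  The dual space is the type of (automatically continuous) linear functionals
  \<open>(real^'n) \<Rightarrow>\<^sub>L real\<close>, so \<open>(real^3) quadratic_form\<close> is the second symmetric power of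
  the dual of \<open>real^3\<close> and \<open>((real^3) \<Rightarrow>\<^sub>L real) quadratic_form\<close> is that of \<open>real^3\<close>.
  A matrix acts on forms by transport of structure: \<open>(A \<cdot> q) x = q (A\<^sup>-\<^sup>1 x)\<close>; on functionals it acts
  by \<open>\<xi> \<mapsto> \<xi> \<circ> A\<^sup>-\<^sup>1\<close>, whence \<open>(A \<cdot> q) \<xi> = q (\<xi> \<circ> A)\<close> for forms on the dual.
\<close>

lift_definition form_rep :: "real^'n^'n \<Rightarrow> (real^'n) quadratic_form \<Rightarrow> (real^'n) quadratic_form"
  is "\<lambda>A q x. q (matrix_inv A *v x)"
proof -
  fix A :: "real^'n^'n" and q :: "real^'n \<Rightarrow> real"
  assume "\<exists>B. bilinear B \<and> q = (\<lambda>x. B x x)"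
  then obtain B where "bilinear B" "q = (\<lambda>x. B x x)"
    by blast
  then show "\<exists>D. bilinear D \<and> (\<lambda>x. q (matrix_inv A *v x)) = (\<lambda>x. D x x)"
    by (intro exI[of _ "\<lambda>x y. B (matrix_inv A *v x) (matrix_inv A *v y)"])
      (auto simp: bilinear_def linear_iff matrix_vector_right_distrib matrix_vector_mult_scaleR)
qed

lift_definition dual_form_rep ::
  "real^'n^'n \<Rightarrow> ((real^'n) \<Rightarrow>\<^sub>L real) quadratic_form \<Rightarrow> ((real^'n) \<Rightarrow>\<^sub>L real) quadratic_form"
  is "\<lambda>A q \<xi>. q (\<xi> o\<^sub>L Blinfun ((*v) A))"
proof -
  fix A :: "real^'n^'n" and q :: "((real^'n) \<Rightarrow>\<^sub>L real) \<Rightarrow> real"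
  assume "\<exists>B. bilinear B \<and> q = (\<lambda>x. B x x)"
  then obtain B where "bilinear B" "q = (\<lambda>x. B x x)"
    by blast
  then show "\<exists>D. bilinear D \<and> (\<lambda>\<xi>. q (\<xi> o\<^sub>L Blinfun ((*v) A))) = (\<lambda>x. D x x)"
    by (intro exI[of _ "\<lambda>\<xi> \<eta>. B (\<xi> o\<^sub>L Blinfun ((*v) A)) (\<eta> o\<^sub>L Blinfun ((*v) A))"])
      (auto simp: bilinear_def linear_iff bounded_bilinear.add_left[OF bounded_bilinear_blinfun_compose]
        bounded_bilinear.scaleR_left[OF bounded_bilinear_blinfun_compose])
qed


section \<open>Projective spaces and projective linear groups\<close>

definition proj_space :: "'v::real_vector set set" where
  "proj_space = {span {v} | v. v \<noteq> 0}"

definition proj_subspace :: "'v::real_vector set set \<Rightarrow> bool" where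
  "proj_subspace S \<longleftrightarrow> (\<exists>W. subspace W \<and> S = {p \<in> proj_space. p \<subseteq> W})"

definition GL :: "('v::real_vector \<Rightarrow> 'v) monoid" where
  "GL = \<lparr>carrier = {f. linear f \<and> bij f}, monoid.mult = (\<circ>), one = id\<rparr>"

definition scalar_maps :: "('v::real_vector \<Rightarrow> 'v) set" where
  "scalar_maps = {(*\<^sub>R) c | c. c \<noteq> 0}"

definition PGL :: "('v::real_vector \<Rightarrow> 'v) set monoid" where
  "PGL = GL Mod scalar_maps"

definition SL :: "(real^'n^'n) monoid" where
  "SL = \<lparr>carrier = {A. det A = 1}, monoid.mult = (**), one = mat 1\<rparr>"

definition PSL :: "(real^'n^'n) set monoid" where
  "PSL = SL Mod {A \<in> carrier SL. \<exists>c. A = mat c}"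

text \<open>All representatives of an element of \<open>PGL\<close> map a given point of the projective space to the
  same point (see \<open>proj_act_coset\<close>), so the union below is a union of equal sets.\<close>

definition proj_act :: "('v::real_vector \<Rightarrow> 'v) set \<Rightarrow> 'v set \<Rightarrow> 'v set" where
  "proj_act g p = (\<Union>f\<in>g. f ` p)"

text \<open>Likewise all representatives of an element of \<open>PSL\<close> give the same class in \<open>PGL\<close>
  (see \<open>proj_rep_coset\<close>).\<close>

definition proj_rep ::
  "(real^'n^'n \<Rightarrow> 'v::real_vector \<Rightarrow> 'v) \<Rightarrow> (real^'n^'n) set \<Rightarrow> ('v \<Rightarrow> 'v) set" where
  "proj_rep \<rho> C = (\<Union>A\<in>C. scalar_maps #>\<^bsub>GL\<^esub> \<rho> A)"

abbreviation conic_rep ::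
  "(real^3^3) set \<Rightarrow> ((real^3) quadratic_form \<Rightarrow> (real^3) quadratic_form) set" where
  "conic_rep \<equiv> proj_rep form_rep"

abbreviation dual_conic_rep ::
  "(real^3^3) set \<Rightarrow> (((real^3) \<Rightarrow>\<^sub>L real) quadratic_form \<Rightarrow> ((real^3) \<Rightarrow>\<^sub>L real) quadratic_form) set" where
  "dual_conic_rep \<equiv> proj_rep dual_form_rep"


section \<open>Elementary subgroups and strong irreducibility\<close>

definition finite_index_subgroup :: "'g set \<Rightarrow> 'g set \<Rightarrow> ('g, 'b) monoid_scheme \<Rightarrow> bool" where
  "finite_index_subgroup H K G \<longleftrightarrow>
     subgroup H (G\<lparr>carrier := K\<rparr>) \<and> finite (rcosets\<^bsub>G\<lparr>carrier := K\<rparr>\<^esub> H)"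

text \<open>A conic is a point of the projective space of nonzero quadratic forms, whatever its
  rank and its real locus.\<close>

definition elementary :: "(real^3^3) set set \<Rightarrow> bool" where
  "elementary \<Gamma> \<longleftrightarrow> (\<exists>H. finite_index_subgroup H \<Gamma> PSL \<and>
     ((\<exists>p \<in> proj_space. \<forall>h\<in>H. proj_act (conic_rep h) p = p) \<or>
      (\<exists>p \<in> proj_space. \<forall>h\<in>H. proj_act (dual_conic_rep h) p = p)))"

definition strongly_irreducible :: "('v::real_vector \<Rightarrow> 'v) set set \<Rightarrow> bool" where
  "strongly_irreducible G \<longleftrightarrow> \<not> (\<exists>F. finite F \<and> F \<noteq> {} \<and>
     (\<forall>S\<in>F. proj_subspace S \<and> S \<noteq> {} \<and> S \<noteq> proj_space) \<and>
     (\<forall>g\<in>G. (\<lambda>S. proj_act g ` S) ` F = F))"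


section \<open>Well-definedness\<close>

lemma group_GL: "group (GL :: ('v::real_vector \<Rightarrow> 'v) monoid)"
proof (rule groupI)
  fix f :: "'v \<Rightarrow> 'v"
  assume "f \<in> carrier GL"
  then have f: "linear f" "bij f"
    by (auto simp: GL_def)
  have "linear (inv_into UNIV f)"
  proof (rule linearI)
    fix x y c
    show "inv_into UNIV f (x + y) = inv_into UNIV f x + inv_into UNIV f y"
      by (rule injD[OF bij_is_inj[OF f(2)]]) (simp add: linear_add[OF f(1)] bij_inv_eq_iff surj_f_inv_f bij_is_surj f(2))
    show "inv_into UNIV f (c *\<^sub>R x) = c *\<^sub>R inv_into UNIV f x"
      by (rule injD[OF bij_is_inj[OF f(2)]]) (simp add: linear_scale[OF f(1)] surj_f_inv_f bij_is_surj f(2))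
  qed
  then show "\<exists>g\<in>carrier GL. g \<otimes>\<^bsub>GL\<^esub> f = \<one>\<^bsub>GL\<^esub>"
    using f by (intro bexI[of _ "inv_into UNIV f"]) (auto simp: GL_def bij_imp_bij_inv bij_is_inj)
qed (auto simp: GL_def linear_compose bij_comp linear_id o_assoc)

lemma scalar_maps_normal: "scalar_maps \<lhd> (GL :: ('v::real_vector \<Rightarrow> 'v) monoid)"
proof -
  interpret group "GL :: ('v \<Rightarrow> 'v) monoid" by (rule group_GL)
  have bij_scale: "bij ((*\<^sub>R) c :: 'v \<Rightarrow> 'v)" if "c \<noteq> 0" for c
    by (rule o_bij[of "(*\<^sub>R) (1 / c)"]) (use that in auto)
  have sub: "scalar_maps \<subseteq> carrier (GL :: ('v \<Rightarrow> 'v) monoid)"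
    by (auto simp: scalar_maps_def GL_def bij_scale)
  have "subgroup scalar_maps (GL :: ('v \<Rightarrow> 'v) monoid)"
  proof (rule subgroupI)
    show "scalar_maps \<noteq> ({} :: ('v \<Rightarrow> 'v) set)"
      by (auto simp: scalar_maps_def)
    fix f g :: "'v \<Rightarrow> 'v"
    assume f: "f \<in> scalar_maps"
    then obtain c where c: "c \<noteq> 0" "f = (*\<^sub>R) c"
      by (auto simp: scalar_maps_def)
    have "inv\<^bsub>GL\<^esub> f = (*\<^sub>R) (1 / c)"
      by (rule inv_equality) (use c sub f in \<open>auto simp: GL_def bij_scale o_def\<close>)
    then show "inv\<^bsub>GL\<^esub> f \<in> scalar_maps"
      using c by (auto simp: scalar_maps_def intro!: exI[of _ "1 / c"])
    assume "g \<in> scalar_maps"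
    then obtain d where d: "d \<noteq> 0" "g = (*\<^sub>R) d"
      by (auto simp: scalar_maps_def)
    then show "f \<otimes>\<^bsub>GL\<^esub> g \<in> scalar_maps"
      using c by (auto simp: scalar_maps_def GL_def fun_eq_iff intro!: exI[of _ "c * d"])
  qed (use sub in auto)
  moreover have "f \<otimes>\<^bsub>GL\<^esub> s \<otimes>\<^bsub>GL\<^esub> inv\<^bsub>GL\<^esub> f \<in> scalar_maps"
    if f: "f \<in> carrier GL" and s: "s \<in> scalar_maps" for f s :: "'v \<Rightarrow> 'v"
  proof -
    have "f \<otimes>\<^bsub>GL\<^esub> s = s \<otimes>\<^bsub>GL\<^esub> f"
      using f s by (auto simp: GL_def scalar_maps_def fun_eq_iff linear_scale)
    then have "f \<otimes>\<^bsub>GL\<^esub> s \<otimes>\<^bsub>GL\<^esub> inv\<^bsub>GL\<^esub> f = s"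
      using f s sub by (simp add: m_assoc subset_iff)
    with s show ?thesis by simp
  qed
  ultimately show ?thesis
    by (simp add: normal_inv_iff)
qed

lemma group_PGL: "group (PGL :: ('v::real_vector \<Rightarrow> 'v) set monoid)"
  unfolding PGL_def by (rule normal.factorgroup_is_group[OF scalar_maps_normal])

lemma proj_act_coset:
  assumes "subspace p" and "linear f"
  shows "proj_act (scalar_maps #>\<^bsub>GL\<^esub> f) p = f ` p"
proof -
  have "((*\<^sub>R) c \<circ> f) ` p = f ` p" if "c \<noteq> 0" for c
  proof
    show "((*\<^sub>R) c \<circ> f) ` p \<subseteq> f ` p"
      using subspace_scale[OF \<open>subspace p\<close>] by (auto simp flip: linear_scale[OF \<open>linear f\<close>])
    show "f ` p \<subseteq> ((*\<^sub>R) c \<circ> f) ` p"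
    proof
      fix y assume "y \<in> f ` p"
      then obtain x where x: "x \<in> p" "y = f x" by blast
      then have "y = ((*\<^sub>R) c \<circ> f) ((1 / c) *\<^sub>R x)"
        using \<open>c \<noteq> 0\<close> by (simp add: linear_scale[OF \<open>linear f\<close>])
      then show "y \<in> ((*\<^sub>R) c \<circ> f) ` p"
        using subspace_scale[OF \<open>subspace p\<close> x(1)] by blast
    qed
  qed
  moreover have "\<exists>c. c \<noteq> 0 \<and> f' = (*\<^sub>R) c \<circ> f" if "f' \<in> scalar_maps #>\<^bsub>GL\<^esub> f" for f'
    using that by (auto simp: r_coset_def scalar_maps_def GL_def)
  ultimately have "f' ` p = f ` p" if "f' \<in> scalar_maps #>\<^bsub>GL\<^esub> f" for f'
    using that by metis
  moreover have "f \<in> scalar_maps #>\<^bsub>GL\<^esub> f"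
    by (auto simp: r_coset_def scalar_maps_def GL_def fun_eq_iff intro!: exI[of _ 1])
  ultimately show ?thesis
    unfolding proj_act_def by blast
qed

lemma group_SL: "group (SL :: (real^'n^'n) monoid)"
proof (rule groupI)
  fix A :: "real^'n^'n"
  assume "A \<in> carrier SL"
  then have A: "det A = 1" by (simp add: SL_def)
  then obtain B where B: "A ** B = mat 1" "B ** A = mat 1"
    using invertible_det_nz[of A] by (auto simp: invertible_def)
  then have "det B = 1"
    using A det_mul[of A B] by simp
  with B show "\<exists>B\<in>carrier SL. B \<otimes>\<^bsub>SL\<^esub> A = \<one>\<^bsub>SL\<^esub>"
    by (auto simp: SL_def)
qed (auto simp: SL_def det_mul matrix_mul_assoc)

lemma mat_eq_scaleR: "mat c = c *\<^sub>R (mat 1 :: real^'n^'n)"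
  by (simp add: mat_def vec_eq_iff)

lemma SL_scalars_normal: "{A \<in> carrier SL. \<exists>c. A = mat c} \<lhd> (SL :: (real^'n^'n) monoid)"
proof -
  interpret group "SL :: (real^'n^'n) monoid" by (rule group_SL)
  let ?Z = "{A \<in> carrier SL. \<exists>c. A = (mat c :: real^'n^'n)}"
  have comm: "A ** mat c = mat c ** A" for A :: "real^'n^'n" and c
    by (simp add: mat_eq_scaleR[of c] matrix_scalar_ac flip: scalar_matrix_assoc)
  have mm: "mat c ** mat d = (mat (c * d) :: real^'n^'n)" for c d
    by (simp add: mat_eq_scaleR[of c] mat_eq_scaleR[of d] mat_eq_scaleR[of "c * d"]
        matrix_scalar_ac flip: scalar_matrix_assoc)
  have "det (0 :: real^'n^'n) = 0"
    by (rule det_zero_row(1)) (simp add: row_def vec_eq_iff)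
  then have nz: "c \<noteq> 0" if "mat c \<in> carrier (SL :: (real^'n^'n) monoid)" for c
    using that by (cases "c = 0") (auto simp: SL_def mat_eq_scaleR[of 0])
  have "subgroup ?Z SL"
  proof (rule subgroupI)
    have "\<one>\<^bsub>SL\<^esub> \<in> ?Z" by (auto simp: SL_def)
    then show "?Z \<noteq> {}" by blast
    fix A B assume A: "A \<in> ?Z"
    then obtain c where c: "A = mat c" "A \<in> carrier SL" by auto
    have "A ** mat (1 / c) = mat 1"
      using nz c by (auto simp: mm)
    moreover from this have "det A * det (mat (1 / c) :: real^'n^'n) = 1"
      by (metis det_I det_mul)
    then have "mat (1 / c) \<in> carrier (SL :: (real^'n^'n) monoid)"
      using c by (simp add: SL_def)
    ultimately have "inv\<^bsub>SL\<^esub> A = mat (1 / c)"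
      using c comm[of "mat (1/c)" c] by (intro inv_equality) (auto simp: SL_def)
    with \<open>mat (1 / c) \<in> carrier SL\<close> show "inv\<^bsub>SL\<^esub> A \<in> ?Z" by auto
    assume "B \<in> ?Z"
    with A show "A \<otimes>\<^bsub>SL\<^esub> B \<in> ?Z"
      by (auto simp: SL_def det_mul mm)
  qed auto
  moreover have "A \<otimes>\<^bsub>SL\<^esub> Z \<otimes>\<^bsub>SL\<^esub> inv\<^bsub>SL\<^esub> A \<in> ?Z" if A: "A \<in> carrier SL" and Z: "Z \<in> ?Z" for A Z
  proof -
    have "A \<otimes>\<^bsub>SL\<^esub> Z = Z \<otimes>\<^bsub>SL\<^esub> A"
      using Z comm by (auto simp: SL_def)
    then have "A \<otimes>\<^bsub>SL\<^esub> Z \<otimes>\<^bsub>SL\<^esub> inv\<^bsub>SL\<^esub> A = Z"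
      using A Z by (simp add: m_assoc)
    with Z show ?thesis by simp
  qed
  ultimately show ?thesis
    by (simp add: normal_inv_iff)
qed

lemma group_PSL: "group (PSL :: (real^'n^'n) set monoid)"
  unfolding PSL_def by (rule normal.factorgroup_is_group[OF SL_scalars_normal])


lemma proj_rep_coset:
  assumes hom: "\<rho> \<in> hom (SL :: (real^'n^'n) monoid) (GL :: ('v::real_vector \<Rightarrow> 'v) monoid)"
    and scalar: "\<And>c. mat c \<in> carrier (SL :: (real^'n^'n) monoid) \<Longrightarrow> \<rho> (mat c) \<in> scalar_maps"
    and A: "A \<in> carrier SL"
  shows "proj_rep \<rho> ({Z \<in> carrier SL. \<exists>c. Z = mat c} #>\<^bsub>SL\<^esub> A) = scalar_maps #>\<^bsub>GL\<^esub> \<rho> A"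
proof -
  let ?Z = "{Z \<in> carrier SL. \<exists>c. Z = (mat c :: real^'n^'n)}"
  interpret SL: group "SL :: (real^'n^'n) monoid" by (rule group_SL)
  interpret GL: group "GL :: ('v \<Rightarrow> 'v) monoid" by (rule group_GL)
  interpret S: normal scalar_maps "GL :: ('v \<Rightarrow> 'v) monoid" by (rule scalar_maps_normal)
  have "scalar_maps #>\<^bsub>GL\<^esub> \<rho> (Z \<otimes>\<^bsub>SL\<^esub> A) = scalar_maps #>\<^bsub>GL\<^esub> \<rho> A" if Z: "Z \<in> ?Z" for Z
  proof -
    have "\<rho> (Z \<otimes>\<^bsub>SL\<^esub> A) = \<rho> Z \<otimes>\<^bsub>GL\<^esub> \<rho> A"
      using Z A hom by (auto simp: hom_def)
    moreover have "\<rho> Z \<in> scalar_maps"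
      using Z scalar by auto
    moreover have "\<rho> A \<in> carrier GL"
      using A hom by (auto simp: hom_def)
    ultimately show ?thesis
      using GL.coset_mult_assoc[of scalar_maps "\<rho> Z" "\<rho> A"] S.subset
        S.rcos_const[OF GL.is_group, of "\<rho> Z"]
      by (metis subsetD)
  qed
  moreover have "?Z \<noteq> {}"
    by (auto simp: SL_def intro!: exI[of _ "mat 1"])
  moreover have "proj_rep \<rho> (?Z #>\<^bsub>SL\<^esub> A) =
      (\<Union>Z\<in>?Z. scalar_maps #>\<^bsub>GL\<^esub> \<rho> (Z \<otimes>\<^bsub>SL\<^esub> A))"
    unfolding proj_rep_def r_coset_def[of SL] by blast
  ultimately show ?thesis
    by (metis (no_types, lifting) SUP_eq_const)
qed

lemma proj_rep_hom:
  assumes hom: "\<rho> \<in> hom (SL :: (real^'n^'n) monoid) (GL :: ('v::real_vector \<Rightarrow> 'v) monoid)"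
    and scalar: "\<And>c. mat c \<in> carrier (SL :: (real^'n^'n) monoid) \<Longrightarrow> \<rho> (mat c) \<in> scalar_maps"
  shows "proj_rep \<rho> \<in> hom PSL PGL"
proof (rule homI)
  let ?Z = "{Z \<in> carrier SL. \<exists>c. Z = (mat c :: real^'n^'n)}"
  interpret SL: group "SL :: (real^'n^'n) monoid" by (rule group_SL)
  interpret Z: normal ?Z "SL :: (real^'n^'n) monoid" by (rule SL_scalars_normal)
  interpret S: normal scalar_maps "GL :: ('v \<Rightarrow> 'v) monoid" by (rule scalar_maps_normal)
  have coset: "proj_rep \<rho> (?Z #>\<^bsub>SL\<^esub> B) = scalar_maps #>\<^bsub>GL\<^esub> \<rho> B" if "B \<in> carrier SL" for B
    by (rule proj_rep_coset[OF hom _ that]) (rule scalar)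
  fix C assume "C \<in> carrier (PSL :: (real^'n^'n) set monoid)"
  then obtain A where A: "A \<in> carrier SL" "C = ?Z #>\<^bsub>SL\<^esub> A"
    unfolding PSL_def carrier_FactGroup by (rule imageE)
  have rA: "\<rho> B \<in> carrier GL" if "B \<in> carrier SL" for B
    by (rule hom_in_carrier[OF hom that])
  show "proj_rep \<rho> C \<in> carrier PGL"
    unfolding A(2) coset[OF A(1)] PGL_def carrier_FactGroup using rA[OF A(1)] by (rule imageI)
  fix D assume "D \<in> carrier (PSL :: (real^'n^'n) set monoid)"
  then obtain B where B: "B \<in> carrier SL" "D = ?Z #>\<^bsub>SL\<^esub> B"
    unfolding PSL_def carrier_FactGroup by (rule imageE)
  have "C \<otimes>\<^bsub>PSL\<^esub> D = ?Z #>\<^bsub>SL\<^esub> (A \<otimes>\<^bsub>SL\<^esub> B)"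
    unfolding A(2) B(2) PSL_def mult_FactGroup by (rule Z.rcos_sum[OF A(1) B(1)])
  then have "proj_rep \<rho> (C \<otimes>\<^bsub>PSL\<^esub> D) = scalar_maps #>\<^bsub>GL\<^esub> \<rho> (A \<otimes>\<^bsub>SL\<^esub> B)"
    using coset[OF SL.m_closed[OF A(1) B(1)]] by (simp only:)
  also have "\<rho> (A \<otimes>\<^bsub>SL\<^esub> B) = \<rho> A \<otimes>\<^bsub>GL\<^esub> \<rho> B"
    by (rule hom_mult[OF hom A(1) B(1)])
  also have "scalar_maps #>\<^bsub>GL\<^esub> (\<rho> A \<otimes>\<^bsub>GL\<^esub> \<rho> B) = proj_rep \<rho> C \<otimes>\<^bsub>PGL\<^esub> proj_rep \<rho> D"
    unfolding A(2) B(2) coset[OF A(1)] coset[OF B(1)] PGL_def mult_FactGroup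
    by (rule S.rcos_sum[OF rA[OF A(1)] rA[OF B(1)], symmetric])
  finally show "proj_rep \<rho> (C \<otimes>\<^bsub>PSL\<^esub> D) = proj_rep \<rho> C \<otimes>\<^bsub>PGL\<^esub> proj_rep \<rho> D" .
qed

lemma SL_matrix_inv:
  fixes A :: "real^'n^'n"
  assumes "A \<in> carrier SL"
  shows "A ** matrix_inv A = mat 1" "matrix_inv A ** A = mat 1"
proof -
  have "invertible A"
    using assms by (simp add: SL_def invertible_det_nz)
  then have "A ** matrix_inv A = mat 1 \<and> matrix_inv A ** A = mat 1"
    unfolding invertible_def matrix_inv_def by (rule someI_ex)
  then show "A ** matrix_inv A = mat 1" "matrix_inv A ** A = mat 1"
    by blast+
qed

lemma linear_form_rep: "linear (form_rep A)"
  by (rule linearI; transfer) auto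

lemma linear_dual_form_rep: "linear (dual_form_rep A)"
  by (rule linearI; transfer) auto

lemma form_rep_mult:
  assumes "A \<in> carrier SL" "B \<in> carrier SL"
  shows "form_rep (A ** B) = form_rep A \<circ> form_rep B"
proof -
  have "(matrix_inv B ** matrix_inv A) ** (A ** B) = matrix_inv B ** (matrix_inv A ** A) ** B"
    by (simp only: matrix_mul_assoc)
  also have "\<dots> = mat 1"
    using assms by (simp add: SL_matrix_inv)
  finally have 1: "(matrix_inv B ** matrix_inv A) ** (A ** B) = mat 1" .
  have "A ** B \<in> carrier SL"
    using assms by (simp add: SL_def det_mul)
  then have "matrix_inv B ** matrix_inv A = matrix_inv (A ** B)"
    using 1 by (metis SL_matrix_inv(1) matrix_mul_assoc matrix_mul_lid matrix_mul_rid)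
  then have "form_rep (A ** B) q = form_rep A (form_rep B q)" for q
    by (intro form_at_inject[THEN iffD1] ext)
      (simp add: form_rep.rep_eq matrix_vector_mul_assoc)
  then show ?thesis by auto
qed

lemma Blinfun_mult: "Blinfun ((*v) (A ** B)) = Blinfun ((*v) A) o\<^sub>L Blinfun ((*v) B)"
  for A :: "real^'n^'m" and B :: "real^'k^'n"
  by (rule blinfun_eqI) (simp add: bounded_linear_Blinfun_apply matrix_vector_mul_assoc)

lemma dual_form_rep_mult: "dual_form_rep (A ** B :: real^'n^'n) = dual_form_rep A \<circ> dual_form_rep B"
proof -
  have assoc: "\<xi> o\<^sub>L (f o\<^sub>L g) = (\<xi> o\<^sub>L f) o\<^sub>L g"
    for \<xi> :: "(real^'n) \<Rightarrow>\<^sub>L real" and f g :: "(real^'n) \<Rightarrow>\<^sub>L (real^'n)"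
    by (rule blinfun_eqI) simp
  have "dual_form_rep (A ** B) q = dual_form_rep A (dual_form_rep B q)" for q
    by (intro form_at_inject[THEN iffD1] ext)
      (simp add: dual_form_rep.rep_eq Blinfun_mult assoc)
  then show ?thesis by auto
qed

lemma form_rep_one: "form_rep (mat 1 :: real^'n^'n) = id"
proof -
  have "matrix_inv (mat 1) = (mat 1 :: real^'n^'n)"
    using SL_matrix_inv[of "mat 1 :: real^'n^'n"] by (simp add: SL_def)
  then show ?thesis
    by (intro ext form_at_inject[THEN iffD1]) (simp add: form_rep.rep_eq)
qed

lemma dual_form_rep_one: "dual_form_rep (mat 1 :: real^'n^'n) = id"
proof -
  have "\<xi> o\<^sub>L Blinfun ((*v) (mat 1)) = \<xi>" for \<xi> :: "(real^'n) \<Rightarrow>\<^sub>L real"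
    by (rule blinfun_eqI) (simp add: bounded_linear_Blinfun_apply)
  then show ?thesis
    by (intro ext form_at_inject[THEN iffD1]) (simp add: dual_form_rep.rep_eq)
qed

lemma hom_SL_GL_I:
  fixes \<rho> :: "real^'n^'n \<Rightarrow> 'v::real_vector \<Rightarrow> 'v"
  assumes "\<And>A. linear (\<rho> A)" "\<rho> (mat 1) = id"
    and mult: "\<And>A B. A \<in> carrier SL \<Longrightarrow> B \<in> carrier SL \<Longrightarrow> \<rho> (A ** B) = \<rho> A \<circ> \<rho> B"
  shows "\<rho> \<in> hom SL GL"
proof (rule homI)
  interpret group "SL :: (real^'n^'n) monoid" by (rule group_SL)
  fix A :: "real^'n^'n" assume A: "A \<in> carrier SL"
  then have "\<rho> A \<circ> \<rho> (inv\<^bsub>SL\<^esub> A) = id" "\<rho> (inv\<^bsub>SL\<^esub> A) \<circ> \<rho> A = id"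
    using assms(2) r_inv[OF A] l_inv[OF A] by (simp_all flip: mult, simp_all add: SL_def)
  then show "\<rho> A \<in> carrier GL"
    using assms(1) by (auto simp: GL_def intro: o_bij)
  fix B :: "real^'n^'n" assume "B \<in> carrier SL"
  then show "\<rho> (A \<otimes>\<^bsub>SL\<^esub> B) = \<rho> A \<otimes>\<^bsub>GL\<^esub> \<rho> B"
    using A mult[of A B] by (simp add: SL_def GL_def)
qed

lemma SL3_scalar: "mat c \<in> carrier (SL :: (real^3^3) monoid) \<Longrightarrow> c = 1"
proof -
  assume "mat c \<in> carrier (SL :: (real^3^3) monoid)"
  then have "c ^ 3 = 1"
    by (simp add: SL_def det_3 mat_def power3_eq_cube)
  then show "c = 1"
    using power_eq_iff_eq_base[of 3 c 1] by (metis odd_real_root_unique odd_numeral power_one)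
qed

lemma id_in_scalar_maps: "id \<in> scalar_maps"
  by (auto simp: scalar_maps_def fun_eq_iff intro!: exI[of _ 1])

lemma conic_rep_hom: "conic_rep \<in> hom PSL PGL"
  by (intro proj_rep_hom hom_SL_GL_I linear_form_rep form_rep_one form_rep_mult)
    (auto dest!: SL3_scalar simp: form_rep_one id_in_scalar_maps)

lemma dual_conic_rep_hom: "dual_conic_rep \<in> hom PSL PGL"
  by (intro proj_rep_hom hom_SL_GL_I linear_dual_form_rep dual_form_rep_one dual_form_rep_mult)
    (auto dest!: SL3_scalar simp: dual_form_rep_one id_in_scalar_maps)

end

theory Submission
  imports Defs
begin

text \<open>
  The content is that a subgroup \<open>G\<close> of \<open>SL(3)\<close> preserving a proper nonzero space \<open>W\<close> of quadratic
  forms has, on conics or on dual conics, a point with finite orbit. If \<open>G\<close> is bounded, it fixes a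
  positive definite form. Otherwise some rescaled sequence \<open>s\<^sub>n B\<^sub>n\<close> in \<open>G\<close> converges to a rank one
  matrix \<open>v w\<^sup>T\<close> (if the first limit has rank two, pass to inverses, which are transposed cofactor
  matrices). A form \<open>S \<in> W\<close> then converges under \<open>B\<^sub>n\<close> to \<open>S(v) w w\<^sup>T\<close>. So either every form in
  \<open>W\<close> vanishes on the orbit of \<open>v\<close>, or \<open>W\<close> contains the squares of the orbit of \<open>w\<close> under the
  transposed group, and this orbit lies in the zero set of any form orthogonal to \<open>W\<close>.

  Thus some orbit of vectors lies on a conic. If only one conic contains it, that conic is fixed.
  Otherwise the orbit lies in the union of a plane and finitely many lines: either the plane is
  invariant, or intersecting it with a translate leaves only finitely many lines, and finitely many
  points have finite orbits. A fixed plane or line gives a double line or a double point as conic or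
  dual conic.
\<close>

section \<open>Finite orbits and finite index\<close>

text \<open>Inverting a right coset of \<open>H\<close> through \<open>r\<close> gives a left coset,
  whose elements move \<open>x\<close> into a translate of the finite \<open>H\<close>-orbit.
  Finitely many such translates cover the whole orbit.\<close>

lemma finite_orbit_of_finite_index:
  assumes "group K" and "subgroup H K" and fin: "finite (rcosets\<^bsub>K\<^esub> H)"
    and act: "\<And>g h y. g \<in> carrier K \<Longrightarrow> h \<in> carrier K \<Longrightarrow> act (g \<otimes>\<^bsub>K\<^esub> h) y = act g (act h y)"
    and orb: "finite ((\<lambda>h. act h x) ` H)"
  shows "finite ((\<lambda>g. act g x) ` carrier K)"
proof -
  interpret group K by fact
  interpret H: subgroup H K by fact
  have "finite ((\<lambda>g. act (inv\<^bsub>K\<^esub> g) x) ` C)" if C: "C \<in> rcosets\<^bsub>K\<^esub> H" for C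
  proof -
    obtain r where r: "r \<in> carrier K" "C = H #>\<^bsub>K\<^esub> r"
      using C by (auto simp: RCOSETS_def)
    have "(\<lambda>g. act (inv\<^bsub>K\<^esub> g) x) ` C \<subseteq> act (inv\<^bsub>K\<^esub> r) ` (\<lambda>h. act h x) ` H"
    proof (intro image_subsetI)
      fix g assume "g \<in> C"
      then obtain h where h: "h \<in> H" "g = h \<otimes>\<^bsub>K\<^esub> r"
        using r(2) by (auto simp: r_coset_def)
      then have "act (inv\<^bsub>K\<^esub> g) x = act (inv\<^bsub>K\<^esub> r) (act (inv\<^bsub>K\<^esub> h) x)"
        using r(1) by (simp add: inv_mult_group act)
      then show "act (inv\<^bsub>K\<^esub> g) x \<in> act (inv\<^bsub>K\<^esub> r) ` (\<lambda>h. act h x) ` H"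
        using h(1) by simp
    qed
    then show ?thesis
      by (rule finite_subset) (intro finite_imageI orb)
  qed
  moreover have "(\<lambda>g. act g x) ` carrier K \<subseteq> (\<Union>C \<in> rcosets\<^bsub>K\<^esub> H. (\<lambda>g. act (inv\<^bsub>K\<^esub> g) x) ` C)"
  proof (intro image_subsetI)
    fix g assume g: "g \<in> carrier K"
    then have "inv\<^bsub>K\<^esub> g \<in> H #>\<^bsub>K\<^esub> inv\<^bsub>K\<^esub> g"
      by (simp add: rcos_self assms(2))
    moreover have "H #>\<^bsub>K\<^esub> inv\<^bsub>K\<^esub> g \<in> rcosets\<^bsub>K\<^esub> H"
      using g by (simp add: H.subset rcosetsI)
    ultimately show "act g x \<in> (\<Union>C \<in> rcosets\<^bsub>K\<^esub> H. (\<lambda>g. act (inv\<^bsub>K\<^esub> g) x) ` C)"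
      using g by (intro UN_I image_eqI) simp_all
  qed
  ultimately show ?thesis
    using fin by (meson finite_UN_I finite_subset)
qed

text \<open>Orbit-stabiliser: the right coset of \<open>g\<close> is determined by where the inverse
  of \<open>g\<close> sends \<open>x\<close>, so there are no more cosets than points in the
  orbit.\<close>

lemma finite_index_stabiliser:
  assumes "group K"
    and one: "act \<one>\<^bsub>K\<^esub> x = x"
    and act: "\<And>g h y. g \<in> carrier K \<Longrightarrow> h \<in> carrier K \<Longrightarrow> act (g \<otimes>\<^bsub>K\<^esub> h) y = act g (act h y)"
    and orb: "finite ((\<lambda>g. act g x) ` carrier K)"
  shows "subgroup {g \<in> carrier K. act g x = x} K" (is "subgroup ?H K")
    and "finite (rcosets\<^bsub>K\<^esub> {g \<in> carrier K. act g x = x})"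
proof -
  interpret group K by fact
  have inv_fix: "act (inv\<^bsub>K\<^esub> g) x = x" if "g \<in> carrier K" "act g x = x" for g
    using act[of "inv\<^bsub>K\<^esub> g" g x] one that by (simp add: l_inv)
  show sub: "subgroup ?H K"
    by (rule subgroupI) (use one inv_fix act in auto)
  define f where "f g = act (inv\<^bsub>K\<^esub> g) x" for g
  define k where "k y = ?H #>\<^bsub>K\<^esub> inv_into (carrier K) f y" for y
  have "?H #>\<^bsub>K\<^esub> g = k (f g)" if g: "g \<in> carrier K" for g
  proof -
    define g' where "g' = inv_into (carrier K) f (f g)"
    have g': "g' \<in> carrier K" "f g' = f g"
      using g by (auto simp: g'_def inv_into_into f_inv_into_f)
    have "act (g \<otimes>\<^bsub>K\<^esub> inv\<^bsub>K\<^esub> g') x = act g (f g)"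
      using g g' act by (simp add: f_def)
    also have "\<dots> = x"
      using g act[of g "inv\<^bsub>K\<^esub> g" x] one by (simp add: f_def)
    finally have "g \<otimes>\<^bsub>K\<^esub> inv\<^bsub>K\<^esub> g' \<in> ?H"
      using g g' by auto
    then have "g \<in> ?H #>\<^bsub>K\<^esub> g'"
      using g g' sub by (meson subgroup.rcos_module is_group)
    then have "?H #>\<^bsub>K\<^esub> g = ?H #>\<^bsub>K\<^esub> g'"
      using g g' sub repr_independence by metis
    then show ?thesis
      by (simp add: k_def g'_def)
  qed
  then have "rcosets\<^bsub>K\<^esub> ?H \<subseteq> k ` f ` carrier K"
    by (auto simp: RCOSETS_def)
  moreover have "f ` carrier K \<subseteq> (\<lambda>g. act g x) ` carrier K"
    by (auto simp: f_def)
  ultimately show "finite (rcosets\<^bsub>K\<^esub> ?H)"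
    using orb by (meson finite_imageI finite_subset)
qed

section \<open>Congruence of matrices\<close>

text \<open>Matrix of the form \<open>S\<close> pulled back along \<open>B\<close>. Pulling back
  reverses products, so this is a right action.\<close>

definition congr_mat :: "real^'n^'n \<Rightarrow> real^'n^'n \<Rightarrow> real^'n^'n" where
  "congr_mat B S = transpose B ** S ** B"

definition outer :: "real^'n \<Rightarrow> real^'n \<Rightarrow> real^'n^'n" where
  "outer v w = (\<chi> i j. v $ i * w $ j)"

lemma congr_mat_mult: "congr_mat (A ** B) S = congr_mat B (congr_mat A S)"
  by (simp add: congr_mat_def matrix_transpose_mul matrix_mul_assoc)

lemma congr_mat_one [simp]: "congr_mat (mat 1) S = S"
  by (simp add: congr_mat_def)

lemma matrix_add_rdistrib: "(A + B) ** C = A ** C + B ** (C :: real^'k^'n)"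
  by (simp add: vec_eq_iff matrix_matrix_mult_def distrib_right sum.distrib)

lemma bilinear_matrix_mult: "bilinear ((**) :: real^'n^'m \<Rightarrow> real^'k^'n \<Rightarrow> real^'k^'m)"
  unfolding bilinear_def linear_iff
  by (simp add: matrix_add_ldistrib matrix_add_rdistrib matrix_scalar_ac flip: scalar_matrix_assoc)

lemma bilinear_matrix_vector_mult: "bilinear ((*v) :: real^'n^'m \<Rightarrow> real^'n \<Rightarrow> real^'m)"
  unfolding bilinear_def linear_iff
  by (simp add: matrix_vector_mult_add_rdistrib matrix_vector_right_distrib
      matrix_vector_mult_scaleR scaleR_matrix_vector_assoc)

lemma linear_congr_mat: "linear (congr_mat B)"
  unfolding linear_iff congr_mat_def
  by (simp add: matrix_add_ldistrib matrix_add_rdistrib matrix_scalar_ac flip: scalar_matrix_assoc)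

lemma congr_mat_scaleR: "congr_mat (c *\<^sub>R B) S = (c * c) *\<^sub>R congr_mat B S"
  by (simp add: congr_mat_def transpose_scalar matrix_scalar_ac flip: scalar_matrix_assoc)

lemma transpose_congr_mat: "transpose (congr_mat B S) = congr_mat B (transpose S)"
  by (simp add: congr_mat_def matrix_transpose_mul matrix_mul_assoc)

lemma inner_congr_mat_vector: "x \<bullet> (congr_mat B S *v x) = (B *v x) \<bullet> (S *v (B *v x))"
  unfolding congr_mat_def
  by (metis dot_lmul_matrix inner_commute matrix_vector_mul_assoc transpose_matrix_vector)

section \<open>Entrywise inner product and rank one matrices\<close>

lemma inner_matrix_mult_left: "(Q :: real^'n^'m) \<bullet> (P ** S) = (transpose P ** Q) \<bullet> S"
proof -
  have "Q \<bullet> (P ** S) = (\<Sum>i\<in>UNIV. \<Sum>j\<in>UNIV. \<Sum>k\<in>UNIV. Q $ i $ j * (P $ i $ k * S $ k $ j))"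
    by (simp add: inner_vec_def matrix_matrix_mult_def sum_distrib_left)
  also have "\<dots> = (\<Sum>i\<in>UNIV. \<Sum>k\<in>UNIV. \<Sum>j\<in>UNIV. Q $ i $ j * (P $ i $ k * S $ k $ j))"
    by (intro sum.cong refl sum.swap)
  also have "\<dots> = (\<Sum>k\<in>UNIV. \<Sum>i\<in>UNIV. \<Sum>j\<in>UNIV. Q $ i $ j * (P $ i $ k * S $ k $ j))"
    by (rule sum.swap)
  also have "\<dots> = (\<Sum>k\<in>UNIV. \<Sum>j\<in>UNIV. \<Sum>i\<in>UNIV. Q $ i $ j * (P $ i $ k * S $ k $ j))"
    by (intro sum.cong refl sum.swap)
  also have "\<dots> = (transpose P ** Q) \<bullet> S"
    by (simp add: inner_vec_def matrix_matrix_mult_def sum_distrib_left sum_distrib_right transpose_def mult_ac)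
  finally show ?thesis .
qed

lemma inner_transpose: "(transpose A) \<bullet> (transpose B) = A \<bullet> (B :: real^'n^'m)"
  by (simp add: inner_vec_def transpose_def) (rule sum.swap)

lemma inner_matrix_mult_right: "(Q :: real^'n^'m) \<bullet> (S ** P) = (Q ** transpose P) \<bullet> S"
proof -
  have "Q \<bullet> (S ** P) = transpose Q \<bullet> (transpose P ** transpose S)"
    by (simp flip: inner_transpose[of Q] add: matrix_transpose_mul)
  also have "\<dots> = (P ** transpose Q) \<bullet> transpose S"
    by (simp add: inner_matrix_mult_left)
  also have "\<dots> = (Q ** transpose P) \<bullet> S"
    by (simp flip: inner_transpose[of _ S] add: matrix_transpose_mul)
  finally show ?thesis .
qed

text \<open>Congruences by a matrix and by its transpose are adjoint; this is what makes the pairing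
  of conics with dual conics invariant.\<close>

lemma inner_congr_mat: "Q \<bullet> congr_mat B S = congr_mat (transpose B) Q \<bullet> S"
proof -
  have "Q \<bullet> congr_mat B S = (Q ** transpose B) \<bullet> (transpose B ** S)"
    unfolding congr_mat_def by (rule inner_matrix_mult_right)
  also have "\<dots> = (transpose (transpose B) ** (Q ** transpose B)) \<bullet> S"
    by (rule inner_matrix_mult_left)
  finally show ?thesis
    by (simp add: congr_mat_def matrix_mul_assoc)
qed

text \<open>For \<open>v = w\<close>, orthogonality of a form to the square of a vector means that
  the form vanishes at that vector.\<close>

lemma inner_outer: "Q \<bullet> outer v w = v \<bullet> (Q *v w)"
  by (simp add: inner_vec_def outer_def matrix_vector_mult_def sum_distrib_left ac_simps)

lemma outer_matrix_mult: "outer v w ** B = outer v (transpose B *v w)"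
  by (simp add: outer_def vec_eq_iff matrix_matrix_mult_def matrix_vector_mult_def
      transpose_def sum_distrib_left mult_ac del: transpose_matrix_vector)

lemma transpose_outer: "transpose (outer v w) = outer w v"
  by (simp add: outer_def transpose_def vec_eq_iff mult.commute)

lemma matrix_mult_outer: "B ** outer v w = outer (B *v v) w"
  by (metis outer_matrix_mult matrix_transpose_mul transpose_outer transpose_transpose)

lemma congr_mat_outer: "congr_mat B (outer v w) = outer (transpose B *v v) (transpose B *v w)"
  by (simp add: congr_mat_def outer_matrix_mult matrix_mult_outer del: transpose_matrix_vector)

lemma outer_matrix_vector_mult: "outer v w *v x = (w \<bullet> x) *\<^sub>R v"
  by (simp add: outer_def vec_eq_iff matrix_vector_mult_def inner_vec_def sum_distrib_left sum_distrib_right mult_ac)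

text \<open>Computes the limits in the unbounded case: every form collapses to a multiple of one
  double line, the multiple being its value at \<open>v\<close>.\<close>

lemma congr_mat_outer_rank_one: "congr_mat (outer v w) S = (v \<bullet> (S *v v)) *\<^sub>R outer w w"
proof -
  have "congr_mat (outer v w) S = outer (outer w v *v (S *v v)) w"
    by (simp add: congr_mat_def transpose_outer matrix_mult_outer matrix_vector_mul_assoc)
  also have "\<dots> = (v \<bullet> (S *v v)) *\<^sub>R outer w w"
    unfolding outer_matrix_vector_mult by (simp add: outer_def vec_eq_iff)
  finally show ?thesis .
qed

lemma outer_self_nonzero: "v \<noteq> 0 \<Longrightarrow> outer v v \<noteq> 0"
  by (auto simp: outer_def vec_eq_iff)

lemma outer_scaleR: "outer (c *\<^sub>R v) (c *\<^sub>R v) = (c * c) *\<^sub>R outer v v"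
  by (simp add: outer_def vec_eq_iff)

text \<open>Polarisation: expanding the form at \<open>x + y\<close> isolates the bilinear
  term.\<close>

lemma symmetric_mat_eq_0:
  fixes S :: "real^'n^'n"
  assumes "transpose S = S" and "\<And>x. x \<bullet> (S *v x) = 0"
  shows "S = 0"
proof -
  have "x \<bullet> (S *v y) = 0" for x y
  proof -
    have "y \<bullet> (S *v x) = x \<bullet> (S *v y)"
      using assms(1) by (metis dot_lmul_matrix inner_commute transpose_matrix_vector)
    then show ?thesis
      using assms(2)[of "x + y"] assms(2)[of x] assms(2)[of y]
      by (simp add: matrix_vector_right_distrib inner_add_left inner_add_right)
  qed
  then have "S *v y = 0" for y
    by (metis inner_eq_zero_iff)
  then show ?thesis
    by (metis matrix_eq matrix_vector_mult_0)
qed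

section \<open>Subgroups of SL as sets of matrices\<close>

lemma SL_subgroupD:
  assumes "subgroup G (SL :: (real^'n^'n) monoid)"
  shows "mat 1 \<in> G" and "A \<in> G \<Longrightarrow> B \<in> G \<Longrightarrow> A ** B \<in> G"
    and "A \<in> G \<Longrightarrow> matrix_inv A \<in> G"
    and "A \<in> G \<Longrightarrow> A ** matrix_inv A = mat 1" and "A \<in> G \<Longrightarrow> matrix_inv A ** A = mat 1"
    and "A \<in> G \<Longrightarrow> det A = 1"
proof -
  interpret group "SL :: (real^'n^'n) monoid" by (rule group_SL)
  interpret G: subgroup G SL by fact
  show "mat 1 \<in> G" using G.one_closed by (simp add: SL_def)
  show "A ** B \<in> G" if "A \<in> G" "B \<in> G" using G.m_closed[OF that] by (simp add: SL_def)
  show inv: "A ** matrix_inv A = mat 1" "matrix_inv A ** A = mat 1" if "A \<in> G"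
    using SL_matrix_inv G.mem_carrier[OF that] by auto
  show "det A = 1" if "A \<in> G" using G.mem_carrier[OF that] by (simp add: SL_def)
  show "matrix_inv A \<in> G" if A: "A \<in> G"
  proof -
    have "det (matrix_inv A) = 1"
      using inv[OF A] \<open>A \<in> G \<Longrightarrow> det A = 1\<close>[OF A] by (metis det_I det_mul mult.left_neutral)
    then have "inv\<^bsub>SL\<^esub> A = matrix_inv A"
      using G.mem_carrier[OF A] inv[OF A] by (intro inv_equality) (auto simp: SL_def)
    then show ?thesis using G.m_inv_closed[OF A] by simp
  qed
qed

lemma SL_subgroupI:
  fixes G :: "(real^'n^'n) set"
  assumes "mat 1 \<in> G" and "\<And>A. A \<in> G \<Longrightarrow> det A = 1"
    and "\<And>A B. A \<in> G \<Longrightarrow> B \<in> G \<Longrightarrow> A ** B \<in> G"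
    and "\<And>A. A \<in> G \<Longrightarrow> \<exists>B\<in>G. B ** A = mat 1"
  shows "subgroup G SL"
proof -
  interpret group "SL :: (real^'n^'n) monoid" by (rule group_SL)
  show ?thesis
  proof (rule subgroupI)
    show "G \<subseteq> carrier SL" using assms by (auto simp: SL_def)
    show "G \<noteq> {}" using assms by auto
    fix A B assume A: "A \<in> G"
    obtain C where C: "C \<in> G" "C ** A = mat 1" using assms(4)[OF A] by blast
    have "inv\<^bsub>SL\<^esub> A = C"
      by (rule inv_equality) (use A C assms(2) in \<open>auto simp: SL_def\<close>)
    then show "inv\<^bsub>SL\<^esub> A \<in> G" using C by simp
    assume "B \<in> G" then show "A \<otimes>\<^bsub>SL\<^esub> B \<in> G" using A assms(3) by (simp add: SL_def)
  qed
qed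

lemma subgroup_transpose_SL:
  fixes G :: "(real^'n^'n) set"
  assumes "subgroup G SL"
  shows "subgroup (transpose ` G) SL"
proof (rule SL_subgroupI)
  note G = SL_subgroupD[OF assms]
  show "mat 1 \<in> transpose ` G" using G(1) by (metis image_eqI transpose_mat)
  show "det A = 1" if "A \<in> transpose ` G" for A using G(6) that by auto
  show "A ** B \<in> transpose ` G" if AB: "A \<in> transpose ` G" "B \<in> transpose ` G" for A B
  proof -
    obtain A' B' where "A = transpose A'" "B = transpose B'" "A' \<in> G" "B' \<in> G"
      using AB by blast
    then show ?thesis
      using G(2)[of B' A'] by (intro image_eqI[of _ _ "B' ** A'"]) (simp_all add: matrix_transpose_mul)
  qed
  show "\<exists>B\<in>transpose ` G. B ** A = mat 1" if A: "A \<in> transpose ` G" for A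
  proof -
    obtain A' where A': "A = transpose A'" "A' \<in> G"
      using A by blast
    then have "transpose (matrix_inv A') ** A = mat 1"
      using G(4)[of A'] by (simp flip: matrix_transpose_mul)
    then show ?thesis
      using G(3)[OF A'(2)] by blast
  qed
qed

section \<open>Bounded groups\<close>

text \<open>The supremum of the norm over \<open>T\<close> is \<open>T\<close>-invariant, and by the parallelogram law its minimum
  over \<open>K\<close> is attained only once.\<close>

lemma bounded_linear_group_fixed_point:
  fixes T :: "('a::euclidean_space \<Rightarrow> 'a) set" and K :: "'a set"
  assumes "T \<noteq> {}" and lin: "\<And>f. f \<in> T \<Longrightarrow> linear f"
    and comp: "\<And>f g. f \<in> T \<Longrightarrow> g \<in> T \<Longrightarrow> f \<circ> g \<in> T"
    and inv: "\<And>f. f \<in> T \<Longrightarrow> \<exists>g\<in>T. g \<circ> f = id"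
    and C: "\<And>f x. f \<in> T \<Longrightarrow> norm (f x) \<le> C * norm x"
    and "compact K" and "convex K" and "K \<noteq> {}"
    and inva: "\<And>f. f \<in> T \<Longrightarrow> f ` K \<subseteq> K"
  shows "\<exists>x\<in>K. \<forall>f\<in>T. f x = x"
proof -
  define n where "n x = (SUP f\<in>T. norm (f x))" for x
  have bdd: "bdd_above ((\<lambda>f. norm (f x)) ` T)" for x
    using C by (intro bdd_aboveI[of _ "C * norm x"]) auto
  have le_n: "norm (f x) \<le> n x" if "f \<in> T" for f x
    unfolding n_def using that bdd by (rule cSUP_upper)
  have n_le: "n x \<le> b" if "\<And>f. f \<in> T \<Longrightarrow> norm (f x) \<le> b" for b x
    unfolding n_def using \<open>T \<noteq> {}\<close> that by (rule cSUP_least)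
  have n_diff: "n x - n y \<le> C * dist x y" for x y
  proof -
    have "n x \<le> n y + C * dist x y"
    proof (rule n_le)
      fix f assume f: "f \<in> T"
      have "norm (f x) \<le> norm (f y) + norm (f (x - y))"
        using norm_triangle_ineq[of "f y" "f x - f y"] by (simp add: linear_diff[OF lin[OF f]])
      then show "norm (f x) \<le> n y + C * dist x y"
        using le_n[OF f, of y] C[OF f, of "x - y"] by (simp add: dist_norm)
    qed
    then show ?thesis by simp
  qed
  obtain f0 where f0: "f0 \<in> T" using \<open>T \<noteq> {}\<close> by blast
  have "continuous_on K n"
  proof (cases "C \<ge> 0")
    case True
    have "dist (n x) (n y) \<le> C * dist x y" for x y
      using n_diff[of x y] n_diff[of y x] by (simp add: dist_real_def dist_commute)
    then have "C-lipschitz_on K n"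
      using True by (auto intro: lipschitz_onI)
    then show ?thesis by (rule lipschitz_on_continuous_on)
  next
    \<comment> \<open>A negative \<open>C\<close> forces every vector to be zero, and then
      \<open>n\<close> is constant.\<close>
    case False
    then have "x = 0" for x :: 'a
      using C[OF f0, of x] norm_ge_zero[of "f0 x"]
      by (metis less_le_not_le linorder_not_le mult_neg_pos norm_le_zero_iff order_trans)
    then show ?thesis
      by (metis continuous_on_const continuous_on_cong)
  qed
  then obtain x where x: "x \<in> K" "\<And>y. y \<in> K \<Longrightarrow> n x \<le> n y"
    using continuous_attains_inf[OF \<open>compact K\<close> \<open>K \<noteq> {}\<close>] by blast
  have unique: "y = x" if y: "y \<in> K" "n y \<le> n x" for y
  proof (rule ccontr)
    assume "y \<noteq> x"
    define z where "z = (1/2) *\<^sub>R x + (1/2) *\<^sub>R y"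
    have "z \<in> K"
      unfolding z_def using x(1) y(1) \<open>convex K\<close> by (intro convexD) auto
    \<comment> \<open>\<open>D\<close> is a positive bound for all of \<open>T\<close>. Applied to
      the inverse of \<open>f\<close> it keeps \<open>f x\<close> and \<open>f y\<close> at distance
      at least \<open>2 * d\<close> for every \<open>f\<close>, so the parallelogram law gives the
      midpoint \<open>z\<close> a gain that is uniform in \<open>f\<close>.\<close>
    define D where "D = max C 1"
    define d where "d = norm (x - y) / (2 * D)"
    have "d > 0"
      using \<open>y \<noteq> x\<close> by (simp add: d_def D_def)
    have "n x \<ge> 0"
      using le_n[OF f0, of x] norm_ge_zero order_trans by blast
    have fz: "(norm (f z))\<^sup>2 \<le> (n x)\<^sup>2 - d\<^sup>2" if f: "f \<in> T" for f
    proof -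
      obtain g where g: "g \<in> T" "g \<circ> f = id" using inv[OF f] by blast
      have "norm (x - y) \<le> C * norm (f (x - y))"
        using C[OF g(1), of "f (x - y)"] g(2) by (metis comp_apply id_apply)
      also have "\<dots> \<le> D * norm (f (x - y))"
        by (intro mult_right_mono) (auto simp: D_def)
      finally have "d \<le> norm (f x - f y) / 2"
        by (simp add: d_def D_def field_simps linear_diff[OF lin[OF f]])
      then have d2: "d\<^sup>2 \<le> (norm (f x - f y))\<^sup>2 / 4"
        using \<open>d > 0\<close> power_mono[of d "norm (f x - f y) / 2" 2] by (simp add: power_divide)
      have fz: "f z = (1/2) *\<^sub>R f x + (1/2) *\<^sub>R f y"
        by (simp add: z_def linear_add[OF lin[OF f]] linear_scale[OF lin[OF f]])
      have "(norm (f z))\<^sup>2 = ((norm (f x))\<^sup>2 + (norm (f y))\<^sup>2) / 2 - (norm (f x - f y))\<^sup>2 / 4"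
        unfolding fz power2_norm_eq_inner
        by (simp add: inner_add_left inner_add_right inner_diff_left inner_diff_right inner_commute field_simps)
      moreover have "(norm (f x))\<^sup>2 \<le> (n x)\<^sup>2"
        using le_n[OF f, of x] by (simp add: power_mono)
      moreover have "(norm (f y))\<^sup>2 \<le> (n x)\<^sup>2"
        using le_n[OF f, of y] y(2) by (intro power_mono) auto
      ultimately show ?thesis using d2 by (simp add: field_simps)
    qed
    have nd: "(n x)\<^sup>2 - d\<^sup>2 \<ge> 0"
      using fz[OF f0] zero_le_power2 order_trans by blast
    have "n z \<le> sqrt ((n x)\<^sup>2 - d\<^sup>2)"
      using fz by (intro n_le real_le_rsqrt)
    also have "\<dots> < sqrt ((n x)\<^sup>2)"
      using \<open>d > 0\<close> by (intro real_sqrt_less_mono) simp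
    finally have "n z < n x" using \<open>n x \<ge> 0\<close> by simp
    then show False using x(2)[OF \<open>z \<in> K\<close>] by simp
  qed
  have "f x = x" if f: "f \<in> T" for f
  proof (rule unique)
    show "f x \<in> K" using inva[OF f] x(1) by blast
    show "n (f x) \<le> n x"
      using le_n comp[OF _ f] by (intro n_le) (metis comp_apply)
  qed
  with x(1) show ?thesis by blast
qed

lemma norm_transpose: "norm (transpose A) = norm (A :: real^'n^'m)"
  by (simp add: norm_eq_sqrt_inner inner_transpose)

text \<open>The fixed point is taken in the closed convex hull of the orbit of the standard form.
  This hull is compact and invariant, and it avoids zero because a bounded group cannot shrink a
  vector arbitrarily.\<close>

lemma bounded_SL_subgroup_fixes_form:
  fixes G :: "(real^'n^'n) set"
  assumes G: "subgroup G SL" and "bounded G"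
  shows "\<exists>S. transpose S = S \<and> S \<noteq> 0 \<and> (\<forall>B\<in>G. congr_mat B S = S)"
proof -
  note SL = SL_subgroupD[OF G]
  obtain M where M: "M > 0" "\<And>B. B \<in> G \<Longrightarrow> norm B \<le> M"
    using \<open>bounded G\<close> by (auto simp: bounded_pos)
  obtain k where k: "k > 0" "\<And>(A :: real^'n^'n) (B :: real^'n^'n). norm (A ** B) \<le> norm A * norm B * k"
    using bounded_bilinear.pos_bounded[OF bilinear_conv_bounded_bilinear[THEN iffD1, OF bilinear_matrix_mult]]
    by blast
  obtain l where l: "l > 0" "\<And>A (x :: real^'n). norm (A *v x) \<le> norm (A :: real^'n^'n) * norm x * l"
    using bounded_bilinear.pos_bounded[OF bilinear_conv_bounded_bilinear[THEN iffD1, OF bilinear_matrix_vector_mult]]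
    by blast
  have bnd: "norm (congr_mat B S) \<le> M * M * k * k * norm S" if B: "B \<in> G" for B S
  proof -
    have "norm (congr_mat B S) \<le> norm (transpose B ** S) * norm B * k"
      unfolding congr_mat_def by (rule k(2))
    also have "\<dots> \<le> (M * norm S * k) * M * k"
    proof (intro mult_mono)
      have "norm (transpose B ** S) \<le> norm B * norm S * k"
        using k(2)[of "transpose B" S] by (simp add: norm_transpose)
      also have "\<dots> \<le> M * norm S * k"
        using M(2)[OF B] k(1) by (intro mult_right_mono) auto
      finally show "norm (transpose B ** S) \<le> M * norm S * k" .
    qed (use M k B in auto)
    finally show ?thesis by (simp add: mult_ac)
  qed
  define R where "R = (\<lambda>B. congr_mat B (mat 1)) ` G"
  obtain u :: "real^'n" where u: "norm u = 1"
    using vector_choose_size[of 1] by auto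
  \<comment> \<open>Inverses are bounded by \<open>M\<close> too, so
    \<open>norm (B *v u) \<ge> 1 / (M * l)\<close> for every \<open>B\<close> in the group. The
    half-space records this as a closed convex condition, which passes to the hull.\<close>
  define P where "P = {S :: real^'n^'n. transpose S = S} \<inter> {S. outer u u \<bullet> S \<ge> 1 / (M * l)\<^sup>2}"
  have "R \<subseteq> P"
  proof
    fix S assume "S \<in> R"
    then obtain B where B: "B \<in> G" "S = congr_mat B (mat 1)" by (auto simp: R_def)
    have "norm u \<le> norm (matrix_inv B) * norm (B *v u) * l"
      using l(2)[of "matrix_inv B" "B *v u"] SL(5)[OF B(1)] by (simp add: matrix_vector_mul_assoc)
    also have "\<dots> \<le> M * norm (B *v u) * l"
      using M(2)[OF SL(3)[OF B(1)]] l(1) by (intro mult_right_mono) auto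
    finally have "1 / (M * l) \<le> norm (B *v u)"
      using M(1) l(1) u by (simp add: field_simps)
    then have "(1 / (M * l))\<^sup>2 \<le> (norm (B *v u))\<^sup>2"
      using M(1) l(1) by (intro power_mono) auto
    also have "\<dots> = outer u u \<bullet> S"
      by (simp add: B(2) inner_outer inner_commute[of "outer u u"] inner_congr_mat_vector power2_norm_eq_inner)
    finally show "S \<in> P"
      by (simp add: P_def B(2) transpose_congr_mat power_divide)
  qed
  moreover have "closed P" "convex P"
  proof -
    have "linear (transpose :: real^'n^'n \<Rightarrow> real^'n^'n)"
      by (rule linearI) (simp_all add: transpose_def vec_eq_iff)
    then have "subspace {S :: real^'n^'n. transpose S = S}"
      by (simp add: subspace_def linear_0 linear_add linear_scale)
    then have "closed {S :: real^'n^'n. transpose S = S}" "convex {S :: real^'n^'n. transpose S = S}"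
      by (simp_all add: closed_subspace subspace_imp_convex)
    then show "closed P" "convex P"
      unfolding P_def
      by (simp_all add: closed_Int convex_Int closed_halfspace_ge convex_halfspace_ge)
  qed
  ultimately have KP: "closure (convex hull R) \<subseteq> P"
    by (simp add: closure_minimal hull_minimal)
  have "\<exists>S\<in>closure (convex hull R). \<forall>f\<in>congr_mat ` G. f S = S"
  proof (rule bounded_linear_group_fixed_point)
    show "congr_mat ` G \<noteq> {}" using SL(1) by blast
    show "linear f" if "f \<in> congr_mat ` G" for f
      using that linear_congr_mat by blast
    show "f \<circ> g \<in> congr_mat ` G" if "f \<in> congr_mat ` G" "g \<in> congr_mat ` G" for f g
    proof -
      obtain A B where "A \<in> G" "B \<in> G" "f = congr_mat A" "g = congr_mat B" using \<open>f \<in> congr_mat ` G\<close> \<open>g \<in> congr_mat ` G\<close> by blast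
      then show ?thesis
        using SL(2)[of B A] by (intro image_eqI[of _ _ "B ** A"]) (auto simp: congr_mat_mult)
    qed
    show "\<exists>g\<in>congr_mat ` G. g \<circ> f = id" if f: "f \<in> congr_mat ` G" for f
    proof -
      obtain A where A: "A \<in> G" "f = congr_mat A" using f by blast
      then have "congr_mat (matrix_inv A) \<circ> f = id"
        using SL(4) by (auto simp: fun_eq_iff simp flip: congr_mat_mult)
      then show ?thesis using SL(3) A by blast
    qed
    show "norm (f S) \<le> M * M * k * k * norm S" if "f \<in> congr_mat ` G" for f S
      using that bnd by blast
    have "bounded R"
      unfolding R_def bounded_iff using bnd by blast
    then show "compact (closure (convex hull R))"
      by (simp add: bounded_convex_hull)
    show "convex (closure (convex hull R))"
      by (simp add: convex_closure)
    show "closure (convex hull R) \<noteq> {}"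
      using SL(1) by (auto simp: R_def)
    show "f ` closure (convex hull R) \<subseteq> closure (convex hull R)" if f: "f \<in> congr_mat ` G" for f
    proof -
      obtain A where A: "A \<in> G" "f = congr_mat A" using f by blast
      have "f ` R \<subseteq> R"
        using A SL(2) by (auto simp: R_def simp flip: congr_mat_mult)
      have "f ` closure (convex hull R) \<subseteq> closure (f ` (convex hull R))"
        using A linear_congr_mat by (intro closure_linear_image_subset) auto
      also have "\<dots> = closure (convex hull (f ` R))"
        using A linear_congr_mat convex_hull_linear_image by metis
      also have "\<dots> \<subseteq> closure (convex hull R)"
        using \<open>f ` R \<subseteq> R\<close> by (intro closure_mono hull_mono)
      finally show ?thesis .
    qed
  qed
  then obtain S where S: "S \<in> closure (convex hull R)" "\<forall>B\<in>G. congr_mat B S = S"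
    by blast
  moreover have "transpose S = S" "S \<noteq> 0"
  proof -
    have "S \<in> P" using S(1) KP by blast
    moreover have "1 / (M * l)\<^sup>2 > 0" using M(1) l(1) by simp
    ultimately show "transpose S = S" "S \<noteq> 0" by (auto simp: P_def)
  qed
  ultimately show ?thesis by blast
qed

section \<open>Rank one limits\<close>

text \<open>The transposed adjugate, by cross products of rows. Unlike the inverse it is polynomial,
  so it makes sense at singular limits.\<close>

definition cofactor_mat :: "real^3^3 \<Rightarrow> real^3^3" where
  "cofactor_mat A = vector [cross3 (A $ 2) (A $ 3), cross3 (A $ 3) (A $ 1), cross3 (A $ 1) (A $ 2)]"

lemma mult_transpose_cofactor_mat: "A ** transpose (cofactor_mat A) = mat (det A)"
  by (simp add: cofactor_mat_def vec_eq_iff forall_3 matrix_matrix_mult_def transpose_def mat_def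
      sum_3 det_3 cross3_def algebra_simps)

text \<open>For singular \<open>A\<close> the 2 by 2 minors of the cofactor matrix vanish, so that
  matrix has rank at most one.\<close>

lemma cofactor_mat_cofactor_mat: "cofactor_mat (cofactor_mat A) = det A *\<^sub>R A"
  by (simp add: cofactor_mat_def vec_eq_iff forall_3 det_3 cross3_def algebra_simps)

lemma cofactor_mat_scaleR: "cofactor_mat (c *\<^sub>R A) = (c * c) *\<^sub>R cofactor_mat A"
  by (simp add: cofactor_mat_def vec_eq_iff forall_3 cross3_def algebra_simps)

lemma matrix_inv_cofactor_mat:
  assumes "det A = 1"
  shows "matrix_inv A = transpose (cofactor_mat A)"
proof -
  have "A \<in> carrier SL" using assms by (simp add: SL_def)
  then have "matrix_inv A ** A = mat 1" by (rule SL_matrix_inv)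
  moreover have "A ** transpose (cofactor_mat A) = mat 1"
    using mult_transpose_cofactor_mat[of A] assms by simp
  ultimately show ?thesis
    by (metis matrix_mul_assoc matrix_mul_lid matrix_mul_rid)
qed

lemma tendsto_cofactor_mat:
  assumes "(f \<longlongrightarrow> A) F"
  shows "((\<lambda>x. cofactor_mat (f x)) \<longlongrightarrow> cofactor_mat A) F"
  unfolding cofactor_mat_def
  by (rule vec_tendstoI, rule vec_tendstoI)
    (auto simp: cross3_def vector_def intro!: tendsto_intros assms)

text \<open>All 2 by 2 minors vanish, so the column and the row through a nonzero entry determine
  the matrix.\<close>

lemma rank_one_of_cofactor_mat_eq_0:
  assumes "cofactor_mat A = 0" and "A \<noteq> 0"
  shows "\<exists>v w. v \<noteq> 0 \<and> w \<noteq> 0 \<and> A = outer v w"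
proof -
  obtain i j where ij: "A $ i $ j \<noteq> 0"
    using \<open>A \<noteq> 0\<close> by (auto simp: vec_eq_iff)
  have "\<forall>k l i j. A $ k $ l * A $ i $ j = A $ k $ j * A $ i $ l"
    using assms(1) by (simp add: cofactor_mat_def vec_eq_iff forall_3 cross3_def algebra_simps)
  then have "A = outer (column j A) ((1 / A $ i $ j) *\<^sub>R row i A)"
    using ij by (simp add: vec_eq_iff outer_def column_def row_def field_simps)
  moreover have "column j A \<noteq> 0" "(1 / A $ i $ j) *\<^sub>R row i A \<noteq> 0"
    using ij by (auto simp: vec_eq_iff column_def row_def)
  ultimately show ?thesis by blast
qed

text \<open>Normalised elements of growing norm accumulate at some \<open>L\<close> on the unit
  sphere. Their determinants are cubes of inverse norms, so \<open>L\<close> is singular, and either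
  \<open>L\<close> or its cofactor matrix has rank one.\<close>

lemma unbounded_SL3_subgroup_rank_one_limit:
  fixes G :: "(real^3^3) set"
  assumes G: "subgroup G SL" and "\<not> bounded G"
  obtains B s v w where "\<And>n :: nat. B n \<in> G" "v \<noteq> 0" "w \<noteq> 0" "(\<lambda>n. s n *\<^sub>R B n) \<longlonglongrightarrow> outer v w"
proof -
  note SL = SL_subgroupD[OF G]
  have "\<forall>n :: nat. \<exists>B\<in>G. norm B > real n + 1"
    using \<open>\<not> bounded G\<close> by (metis bounded_iff linorder_not_le)
  then obtain A where A: "\<And>n. A n \<in> G" "\<And>n. norm (A n) > real n + 1" by metis
  have pos: "norm (A n) > 0" for n using A(2)[of n] by linarith
  define U where "U n = (1 / norm (A n)) *\<^sub>R A n" for n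
  have "U n \<in> sphere 0 1" for n
    using pos[of n] by (simp add: U_def)
  then obtain L r where L: "L \<in> sphere 0 1" "strict_mono r" "(U \<circ> r) \<longlonglongrightarrow> L"
    using compact_sphere[unfolded compact_def] by metis
  then have "L \<noteq> 0" by auto
  have UL: "(\<lambda>n. U (r n)) \<longlonglongrightarrow> L" using L(3) by (simp add: o_def)
  have "det (U n) = (1 / norm (A n)) ^ 3" for n
  proof -
    have "det (c *\<^sub>R X) = c ^ 3 * det X" for c and X :: "real^3^3"
      by (simp add: det_3 algebra_simps power3_eq_cube)
    then show ?thesis using SL(6)[OF A(1)[of n]] by (simp add: U_def)
  qed
  moreover have "(\<lambda>n. 1 / norm (A n)) \<longlonglongrightarrow> 0"
  proof (rule real_tendsto_sandwich[of "\<lambda>_. 0" _ _ "\<lambda>n. 1 / (real n + 1)"])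
    show "\<forall>\<^sub>F n in sequentially. 1 / norm (A n) \<le> 1 / (real n + 1)"
      using A(2) by (intro always_eventually allI frac_le) (auto simp: less_imp_le)
    show "(\<lambda>n. 1 / (real n + 1)) \<longlonglongrightarrow> 0"
      using LIMSEQ_inverse_real_of_nat by (simp add: inverse_eq_divide add.commute)
  qed auto
  ultimately have "(\<lambda>n. det (U n)) \<longlonglongrightarrow> 0"
    using tendsto_power[of "\<lambda>n. 1 / norm (A n)" 0 sequentially 3] by simp
  then have "(\<lambda>n. det (U (r n))) \<longlonglongrightarrow> 0"
    using L(2) LIMSEQ_subseq_LIMSEQ[of "\<lambda>n. det (U n)" 0 r] by (simp add: o_def)
  moreover have "(\<lambda>n. det (U (r n))) \<longlonglongrightarrow> det L"
    unfolding det_3 by (intro tendsto_intros UL)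
  ultimately have "det L = 0"
    using LIMSEQ_unique by blast
  show thesis
  proof (cases "cofactor_mat L = 0")
    case True
    obtain v w where "v \<noteq> 0" "w \<noteq> 0" "L = outer v w"
      using rank_one_of_cofactor_mat_eq_0[OF True \<open>L \<noteq> 0\<close>] by blast
    then show thesis
      using UL A(1) by (intro that[of "\<lambda>n. A (r n)" v w "\<lambda>n. 1 / norm (A (r n))"]) (auto simp: U_def)
  next
    case False
    have "cofactor_mat (cofactor_mat L) = 0"
      using \<open>det L = 0\<close> by (simp add: cofactor_mat_cofactor_mat)
    then obtain v w where vw: "v \<noteq> 0" "w \<noteq> 0" "cofactor_mat L = outer v w"
      using rank_one_of_cofactor_mat_eq_0 False by blast
    have "(\<lambda>n. transpose (cofactor_mat (U (r n)))) \<longlonglongrightarrow> transpose (cofactor_mat L)"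
      unfolding transpose_def by (intro tendsto_intros tendsto_cofactor_mat UL)
    \<comment> \<open>Cofactors are quadratic, hence the squared scaling factor. The transpose
      exchanges \<open>v\<close> and \<open>w\<close> in the limit.\<close>
    moreover have "transpose (cofactor_mat (U n)) = (1 / norm (A n) * (1 / norm (A n))) *\<^sub>R matrix_inv (A n)" for n
      using SL(6)[OF A(1)] by (simp add: U_def cofactor_mat_scaleR transpose_scalar matrix_inv_cofactor_mat)
    ultimately show thesis
      using vw A(1) SL(3)
      by (intro that[of "\<lambda>n. matrix_inv (A (r n))" w v "\<lambda>n. 1 / norm (A (r n)) * (1 / norm (A (r n)))"])
        (simp_all add: transpose_outer)
  qed
qed

section \<open>Orbits on a conic\<close>

text \<open>Both forms are combinations of \<open>q * r\<close>, \<open>p * r\<close>,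
  \<open>p * q\<close> in the coordinates of \<open>x\<close>. At a common zero these products are
  proportional to the cross product of the two coefficient vectors, which leaves a coordinate line
  with the opposite vertex, or finitely many points.\<close>

lemma common_zeros_zero_diagonal:
  fixes S T :: "real^3^3"
  assumes sym: "transpose S = S" "transpose T = T"
    and diag: "\<And>i. S $ i $ i = 0" "\<And>i. T $ i $ i = 0"
    and indep: "\<And>a b. a *\<^sub>R S + b *\<^sub>R T = 0 \<Longrightarrow> a = 0 \<and> b = 0"
  shows "\<exists>n F. n \<noteq> 0 \<and> finite F \<and>
    (\<forall>x. x \<bullet> (S *v x) = 0 \<longrightarrow> x \<bullet> (T *v x) = 0 \<longrightarrow> n \<bullet> x = 0 \<or> (\<exists>f\<in>F. \<exists>c. x = c *\<^sub>R f))"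
proof -
  have S: "S $ 2 $ 1 = S $ 1 $ 2" "S $ 3 $ 1 = S $ 1 $ 3" "S $ 3 $ 2 = S $ 2 $ 3"
    and T: "T $ 2 $ 1 = T $ 1 $ 2" "T $ 3 $ 1 = T $ 1 $ 3" "T $ 3 $ 2 = T $ 2 $ 3"
    using sym by (simp_all add: transpose_def vec_eq_iff)
  \<comment> \<open>The components of that cross product; it is nonzero because the forms are
    independent.\<close>
  define d1 where "d1 = S $ 1 $ 3 * T $ 1 $ 2 - S $ 1 $ 2 * T $ 1 $ 3"
  define d2 where "d2 = S $ 1 $ 2 * T $ 2 $ 3 - S $ 2 $ 3 * T $ 1 $ 2"
  define d3 where "d3 = S $ 2 $ 3 * T $ 1 $ 3 - S $ 1 $ 3 * T $ 2 $ 3"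
  have d: "d1 \<noteq> 0 \<or> d2 \<noteq> 0 \<or> d3 \<noteq> 0"
  proof (rule ccontr)
    assume "\<not> ?thesis"
    then have minors: "S $ 1 $ 3 * T $ 1 $ 2 = S $ 1 $ 2 * T $ 1 $ 3" "S $ 1 $ 2 * T $ 2 $ 3 = S $ 2 $ 3 * T $ 1 $ 2"
      "S $ 2 $ 3 * T $ 1 $ 3 = S $ 1 $ 3 * T $ 2 $ 3"
      by (simp_all add: d1_def d2_def d3_def)
    have comb: "T $ i $ j *\<^sub>R S + (- (S $ i $ j)) *\<^sub>R T = 0" for i j
      using minors exhaust_3[of i] exhaust_3[of j]
      by (auto simp: vec_eq_iff forall_3 S T diag algebra_simps)
    then have "S $ i $ j = 0" for i j
      using indep[OF comb[of i j]] by simp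
    then have "S = 0" by (simp add: vec_eq_iff)
    then show False using indep[of 1 0] by simp
  qed
  \<comment> \<open>The one common zero with no vanishing coordinate. It is needed only when
    \<open>d1\<close>, \<open>d2\<close>, \<open>d3\<close> are all nonzero, so division by zero
    does no harm.\<close>
  define w :: "real^3" where "w = vector [1 / d1, 1 / d2, 1 / d3]"
  define F where "F = {axis 1 1, axis 2 1, axis 3 1, w}"
  \<comment> \<open>If just one of \<open>d1\<close>, \<open>d2\<close>, \<open>d3\<close> is
    nonzero, both conics contain a coordinate line and \<open>n\<close> is its normal. Otherwise
    finitely many points suffice and \<open>axis 3 1\<close> is an arbitrary choice.\<close>
  define n :: "real^3" where
    "n = (if d1 = 0 \<and> d3 = 0 then axis 2 1 else if d2 = 0 \<and> d3 = 0 then axis 1 1 else axis 3 1)"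
  have "n \<bullet> x = 0 \<or> (\<exists>f\<in>F. \<exists>c. x = c *\<^sub>R f)" if x: "x \<bullet> (S *v x) = 0" "x \<bullet> (T *v x) = 0" for x
  proof -
    define p q r where pqr: "p = x $ 1" "q = x $ 2" "r = x $ 3"
    have x1: "x = p *\<^sub>R axis 1 1" if "q = 0" "r = 0"
      using that by (simp add: vec_eq_iff forall_3 axis_def pqr)
    have x2: "x = q *\<^sub>R axis 2 1" if "p = 0" "r = 0"
      using that by (simp add: vec_eq_iff forall_3 axis_def pqr)
    have x3: "x = r *\<^sub>R axis 3 1" if "p = 0" "q = 0"
      using that by (simp add: vec_eq_iff forall_3 axis_def pqr)
    have s: "S $ 2 $ 3 * (q * r) + S $ 1 $ 3 * (p * r) + S $ 1 $ 2 * (p * q) = 0"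
      using x(1) by (simp add: inner_vec_def matrix_vector_mult_def sum_3 S diag pqr algebra_simps)
    have t: "T $ 2 $ 3 * (q * r) + T $ 1 $ 3 * (p * r) + T $ 1 $ 2 * (p * q) = 0"
      using x(2) by (simp add: inner_vec_def matrix_vector_mult_def sum_3 T diag pqr algebra_simps)
    have "q * r * d2 - p * r * d1 = 0" "q * r * d3 - p * q * d1 = 0" "p * r * d3 - p * q * d2 = 0"
      unfolding d1_def d2_def d3_def using s t by algebra+
    then have e: "r * (q * d2 - p * d1) = 0" "q * (r * d3 - p * d1) = 0" "p * (r * d3 - q * d2) = 0"
      by (simp_all add: algebra_simps)
    have n: "n \<bullet> x = (if d1 = 0 \<and> d3 = 0 then q else if d2 = 0 \<and> d3 = 0 then p else r)"
      by (simp add: n_def pqr inner_axis' )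
    have "p = 0 \<Longrightarrow> q = 0 \<or> r = 0 \<or> n \<bullet> x = 0" "q = 0 \<Longrightarrow> p = 0 \<or> r = 0 \<or> n \<bullet> x = 0"
      "r = 0 \<Longrightarrow> p = 0 \<or> q = 0 \<or> n \<bullet> x = 0"
      using e d by (auto simp: n)
    moreover have "d1 \<noteq> 0 \<and> d2 \<noteq> 0 \<and> d3 \<noteq> 0" if "p \<noteq> 0" "q \<noteq> 0" "r \<noteq> 0"
      using e d that by auto
    ultimately consider "q = 0" "r = 0" | "p = 0" "r = 0" | "p = 0" "q = 0" | "n \<bullet> x = 0"
      | "p \<noteq> 0" "q \<noteq> 0" "r \<noteq> 0" "d1 \<noteq> 0" "d2 \<noteq> 0" "d3 \<noteq> 0"
      by blast
    then show ?thesis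
    proof cases
      case 5
      then have "q * d2 = p * d1" "r * d3 = p * d1" using e by auto
      then have "x = (p * d1) *\<^sub>R w"
        using 5 by (simp add: vec_eq_iff forall_3 w_def pqr field_simps)
      then show ?thesis by (auto simp: F_def)
    qed (use x1 x2 x3 in \<open>auto simp: F_def\<close>)
  qed
  moreover have "n \<noteq> 0" by (simp add: n_def axis_eq_0_iff)
  moreover have "finite F" by (simp add: F_def)
  ultimately show ?thesis by blast
qed

lemma cross3_eq_0_imp_scaleR:
  assumes "cross3 x y = 0" and "y \<noteq> 0"
  shows "\<exists>c. x = c *\<^sub>R y"
proof -
  have "collinear {0, y, x}"
    using assms(1) by (simp add: cross_eq_0 insert_commute)
  then show ?thesis
    using assms(2) by (auto simp: collinear_lemma)
qed

text \<open>Unless the common zeros lie in a plane, three of them form a basis; in these coordinates both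
  conics pass through the coordinate points and only their off-diagonal entries remain.\<close>

lemma common_zeros_of_two_conics:
  fixes S T :: "real^3^3"
  assumes sym: "transpose S = S" "transpose T = T"
    and indep: "\<And>a b. a *\<^sub>R S + b *\<^sub>R T = 0 \<Longrightarrow> a = 0 \<and> b = 0"
  shows "\<exists>n F. n \<noteq> 0 \<and> finite F \<and>
    (\<forall>x. x \<bullet> (S *v x) = 0 \<longrightarrow> x \<bullet> (T *v x) = 0 \<longrightarrow> n \<bullet> x = 0 \<or> (\<exists>f\<in>F. \<exists>c. x = c *\<^sub>R f))"
proof -
  define Z where "Z = {x. x \<bullet> (S *v x) = 0 \<and> x \<bullet> (T *v x) = 0}"
  consider (point) "\<And>a b. a \<in> Z \<Longrightarrow> b \<in> Z \<Longrightarrow> cross3 a b = 0"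
    | (line) a b where "a \<in> Z" "b \<in> Z" "cross3 a b \<noteq> 0" "\<And>c. c \<in> Z \<Longrightarrow> c \<bullet> cross3 a b = 0"
    | (basis) a b c where "a \<in> Z" "b \<in> Z" "c \<in> Z" "c \<bullet> cross3 a b \<noteq> 0"
    by metis
  then show ?thesis
  proof cases
    \<comment> \<open>All common zeros lie on one line through the origin; the normal
      \<open>axis 1 1\<close> is an arbitrary nonzero vector.\<close>
    case point
    show ?thesis
    proof (cases "\<exists>a\<in>Z. a \<noteq> 0")
      case True
      then obtain a where "a \<in> Z" "a \<noteq> 0" by blast
      then have "\<exists>c. x = c *\<^sub>R a" if "x \<in> Z" for x
        using point that cross3_eq_0_imp_scaleR by blast
      then show ?thesis
        by (intro exI[of _ "axis 1 1"] exI[of _ "{a}"]) (auto simp: Z_def axis_eq_0_iff)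
    next
      case False
      then show ?thesis
        by (intro exI[of _ "axis 1 1"] exI[of _ "{}"]) (auto simp: Z_def axis_eq_0_iff)
    qed
  next
    case line
    then show ?thesis
      by (intro exI[of _ "cross3 a b"] exI[of _ "{}"]) (auto simp: Z_def inner_commute)
  next
    case basis
    \<comment> \<open>The columns are \<open>c\<close>, \<open>a\<close>, \<open>b\<close> in this
      order, so that the determinant is the triple product. Congruence by \<open>M\<close> puts the
      values of a form at these vectors on its diagonal.\<close>
    define M where "M = transpose (vector [c, a, b] :: real^3^3)"
    have "det M \<noteq> 0"
      using basis(4) by (simp add: M_def dot_cross_det)
    then obtain N where N: "M ** N = mat 1" "N ** M = mat 1"
      using invertible_det_nz[of M] by (auto simp: invertible_def)
    have inv: "M *v (N *v x) = x" "N *v (M *v x) = x" for x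
      by (simp_all add: matrix_vector_mul_assoc N)
    have cols: "M *v axis 1 1 = c" "M *v axis 2 1 = a" "M *v axis 3 1 = b"
      by (simp_all add: M_def matrix_vector_mult_def vec_eq_iff transpose_def axis_def sum_3 forall_3
          del: transpose_matrix_vector)
    have diag: "congr_mat M X $ i $ i = 0" if "c \<bullet> (X *v c) = 0" "a \<bullet> (X *v a) = 0" "b \<bullet> (X *v b) = 0" for X i
    proof -
      have "congr_mat M X $ i $ i = axis i 1 \<bullet> (congr_mat M X *v axis i 1)"
        by (simp add: inner_axis' matrix_vector_mult_basis column_def)
      also have "\<dots> = 0"
        unfolding inner_congr_mat_vector using that exhaust_3[of i] by (auto simp: cols)
      finally show ?thesis .
    qed
    have indep': "s = 0 \<and> t = 0" if st: "s *\<^sub>R congr_mat M S + t *\<^sub>R congr_mat M T = 0" for s t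
    proof (rule indep)
      have "congr_mat M (s *\<^sub>R S + t *\<^sub>R T) = 0"
        using st by (simp add: linear_add[OF linear_congr_mat] linear_scale[OF linear_congr_mat])
      then have "congr_mat N (congr_mat M (s *\<^sub>R S + t *\<^sub>R T)) = 0"
        by (simp add: linear_0[OF linear_congr_mat])
      then show "s *\<^sub>R S + t *\<^sub>R T = 0"
        by (simp add: N flip: congr_mat_mult)
    qed
    obtain n F where nF: "n \<noteq> 0" "finite F"
      "\<And>x. x \<bullet> (congr_mat M S *v x) = 0 \<Longrightarrow> x \<bullet> (congr_mat M T *v x) = 0 \<Longrightarrow>
        n \<bullet> x = 0 \<or> (\<exists>f\<in>F. \<exists>c. x = c *\<^sub>R f)"
      using common_zeros_zero_diagonal[of "congr_mat M S" "congr_mat M T"] sym basis(1-3) indep'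
      by (auto simp: transpose_congr_mat diag Z_def)
    \<comment> \<open>Transport back to the original coordinates: points are moved by
      \<open>M\<close>, normals by the transposed inverse.\<close>
    have "(n v* N) \<bullet> x = 0 \<or> (\<exists>f\<in>(*v) M ` F. \<exists>c. x = c *\<^sub>R f)"
      if x: "x \<bullet> (S *v x) = 0" "x \<bullet> (T *v x) = 0" for x
    proof -
      have "n \<bullet> (N *v x) = 0 \<or> (\<exists>f\<in>F. \<exists>c. N *v x = c *\<^sub>R f)"
        by (rule nF(3)) (simp_all add: inner_congr_mat_vector inv x)
      then show ?thesis
      proof
        assume "\<exists>f\<in>F. \<exists>c. N *v x = c *\<^sub>R f"
        then obtain f c where "f \<in> F" "N *v x = c *\<^sub>R f" by blast
        then have "x = c *\<^sub>R (M *v f)"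
          using inv(1)[of x] by (simp add: matrix_vector_mult_scaleR)
        with \<open>f \<in> F\<close> show ?thesis by blast
      qed (simp add: dot_lmul_matrix)
    qed
    moreover have "n v* N \<noteq> 0"
    proof
      assume "n v* N = 0"
      then have "n \<bullet> (N *v (M *v n)) = 0"
        by (metis dot_lmul_matrix inner_zero_left)
      then show False using nF(1) by (simp add: inv)
    qed
    ultimately show ?thesis
      using nF(2) by blast
  qed
qed

section \<open>From an orbit of vectors on a conic to a finite orbit of conics\<close>

lemma span_singleton_scaleR: "c \<noteq> 0 \<Longrightarrow> span {c *\<^sub>R x} = span {x}" for x :: "'a::real_vector"
  using span_image_scale[of "{x}" "\<lambda>_. c"] by simp

lemma congr_mat_image_span: "congr_mat B ` span {S} = span {congr_mat B S}"
  using linear_span_image[OF linear_congr_mat, of B "{S}"] by simp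

lemma congr_mat_eq_0_iff:
  assumes "subgroup G SL" and "B \<in> G"
  shows "congr_mat B S = 0 \<longleftrightarrow> S = 0"
proof
  assume "congr_mat B S = 0"
  then have "congr_mat (B ** matrix_inv B) S = 0"
    by (simp add: congr_mat_mult linear_0[OF linear_congr_mat])
  then show "S = 0"
    using SL_subgroupD(4)[OF assms] by simp
qed (simp add: linear_0[OF linear_congr_mat])

text \<open>Three witnesses occur: \<open>S\<close> when it is the only conic through the orbit of
  \<open>v\<close>, the double line \<open>outer n n\<close> when the plane orthogonal to
  \<open>n\<close> is invariant, and the double point \<open>outer v v\<close>, as a dual conic,
  when the orbit is spread over finitely many lines through the origin.\<close>

lemma orbit_on_conic:
  fixes G :: "(real^3^3) set"
  assumes G: "subgroup G SL" and "v \<noteq> 0" and S: "transpose S = S" "S \<noteq> 0"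
    and zero: "\<And>B. B \<in> G \<Longrightarrow> (B *v v) \<bullet> (S *v (B *v v)) = 0"
  shows "\<exists>Q. transpose Q = Q \<and> Q \<noteq> 0 \<and>
    (finite ((\<lambda>B. congr_mat B ` span {Q}) ` G) \<or> finite ((\<lambda>B. congr_mat (transpose B) ` span {Q}) ` G))"
proof -
  note SL = SL_subgroupD[OF G]
  \<comment> \<open>The conics through the whole orbit; congruence by the group preserves this
    space.\<close>
  define K where "K = {T. transpose T = T \<and> (\<forall>B\<in>G. (B *v v) \<bullet> (T *v (B *v v)) = 0)}"
  have "S \<in> K" using S zero by (auto simp: K_def)
  show ?thesis
  proof (cases "\<forall>T\<in>K. \<exists>c. T = c *\<^sub>R S")
    case True
    have "congr_mat B ` span {S} = span {S}" if B: "B \<in> G" for B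
    proof -
      have "congr_mat B S \<in> K"
        using S(1) zero[OF SL(2)[OF B]]
        unfolding K_def by (auto simp: transpose_congr_mat inner_congr_mat_vector simp flip: matrix_vector_mul_assoc)
      then obtain c where c: "congr_mat B S = c *\<^sub>R S" using True by blast
      then have "c \<noteq> 0"
        using congr_mat_eq_0_iff[OF G B, of S] S(2) by auto
      then show ?thesis
        by (simp add: congr_mat_image_span c span_singleton_scaleR)
    qed
    then have "(\<lambda>B. congr_mat B ` span {S}) ` G \<subseteq> {span {S}}" by blast
    then have "finite ((\<lambda>B. congr_mat B ` span {S}) ` G)"
      by (rule finite_subset) simp
    then show ?thesis
      using S by blast
  next
    case False
    then obtain T where T: "T \<in> K" "\<And>c. T \<noteq> c *\<^sub>R S" by blast
    have "a = 0 \<and> b = 0" if ab: "a *\<^sub>R S + b *\<^sub>R T = 0" for a b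
    proof -
      have "b = 0"
      proof (rule ccontr)
        assume "b \<noteq> 0"
        have "b *\<^sub>R T = - (a *\<^sub>R S)"
          using ab by (simp add: add_eq_0_iff)
        then have "(1 / b) *\<^sub>R (b *\<^sub>R T) = (- a / b) *\<^sub>R S"
          by simp
        then have "T = (- a / b) *\<^sub>R S"
          using \<open>b \<noteq> 0\<close> by simp
        then show False using T(2) by blast
      qed
      then show ?thesis using ab S(2) by simp
    qed
    then obtain n F where nF: "n \<noteq> 0" "finite F"
      "\<And>x. x \<bullet> (S *v x) = 0 \<Longrightarrow> x \<bullet> (T *v x) = 0 \<Longrightarrow> n \<bullet> x = 0 \<or> (\<exists>f\<in>F. \<exists>c. x = c *\<^sub>R f)"
      using common_zeros_of_two_conics[of S T] S(1) T(1) by (auto simp: K_def)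
    have nF': "n \<bullet> (B *v v) = 0 \<or> (\<exists>f\<in>F. \<exists>c. B *v v = c *\<^sub>R f)" if "B \<in> G" for B
      using nF(3)[of "B *v v"] zero[OF that] T(1) that by (auto simp: K_def)
    \<comment> \<open>Since \<open>n \<bullet> (A *v x) = (transpose A *v n) \<bullet> x\<close>,
      the condition says that the plane orthogonal to \<open>n\<close> is invariant.\<close>
    show ?thesis
    proof (cases "\<forall>A\<in>G. \<exists>c. transpose A *v n = c *\<^sub>R n")
      case True
      have "congr_mat A ` span {outer n n} = span {outer n n}" if A: "A \<in> G" for A
      proof -
        obtain c where c: "transpose A *v n = c *\<^sub>R n" using True A by blast
        have "congr_mat A (outer n n) = (c * c) *\<^sub>R outer n n"
          unfolding congr_mat_outer c by (rule outer_scaleR)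
        moreover from this have "c \<noteq> 0"
          using congr_mat_eq_0_iff[OF G A, of "outer n n"] outer_self_nonzero[OF nF(1)] by auto
        ultimately show ?thesis
          by (simp add: congr_mat_image_span span_singleton_scaleR)
      qed
      then have "(\<lambda>B. congr_mat B ` span {outer n n}) ` G \<subseteq> {span {outer n n}}" by blast
      then have "finite ((\<lambda>B. congr_mat B ` span {outer n n}) ` G)"
        by (rule finite_subset) simp
      then show ?thesis
        using outer_self_nonzero[OF nF(1)] transpose_outer[of n n] by blast
    next
      case False
      then obtain A where A: "A \<in> G" "\<And>c. transpose A *v n \<noteq> c *\<^sub>R n" by blast
      \<comment> \<open>Direction of the intersection of the plane orthogonal to \<open>n\<close>
        with its preimage under \<open>A\<close>.\<close>
      define u where "u = cross3 (transpose A *v n) n"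
      have "u \<noteq> 0"
        using A(2) cross3_eq_0_imp_scaleR[OF _ nF(1)] by (auto simp: u_def)
      \<comment> \<open>The dichotomy is applied to both \<open>B\<close> and \<open>A ** B\<close>:
        either one of them sends \<open>v\<close> to a line of \<open>F\<close>, or
        \<open>B *v v\<close> lies in both planes and hence on the line of \<open>u\<close>.\<close>
      define F' where "F' = F \<union> (*v) (matrix_inv A) ` F \<union> {u}"
      have F': "\<exists>f\<in>F'. \<exists>c. B *v v = c *\<^sub>R f" if B: "B \<in> G" for B
      proof -
        consider "n \<bullet> (B *v v) = 0" "n \<bullet> ((A ** B) *v v) = 0" | f c where "f \<in> F" "B *v v = c *\<^sub>R f"
          | f c where "f \<in> F" "(A ** B) *v v = c *\<^sub>R f"
          using nF'[OF B] nF'[OF SL(2)[OF A(1) B]] by blast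
        then show ?thesis
        proof cases
          case 1
          then have "(transpose A *v n) \<bullet> (B *v v) = 0"
            by (simp add: dot_lmul_matrix matrix_vector_mul_assoc)
          with 1 have "cross3 (B *v v) u = 0"
            unfolding u_def by (simp add: Lagrange inner_commute)
          then show ?thesis
            using cross3_eq_0_imp_scaleR[OF _ \<open>u \<noteq> 0\<close>] by (auto simp: F'_def)
        next
          case 2
          then show ?thesis by (auto simp: F'_def)
        next
          case 3
          have "B *v v = matrix_inv A *v ((A ** B) *v v)"
            using SL(5)[OF A(1)] by (simp add: matrix_vector_mul_assoc matrix_mul_assoc)
          also have "\<dots> = c *\<^sub>R (matrix_inv A *v f)"
            using 3 by (simp add: matrix_vector_mult_scaleR)
          finally show ?thesis
            using 3 by (auto simp: F'_def)
        qed
      qed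
      have "congr_mat (transpose B) ` span {outer v v} \<in> (\<lambda>f. span {outer f f}) ` F'" if B: "B \<in> G" for B
      proof -
        obtain f c where f: "f \<in> F'" "B *v v = c *\<^sub>R f" using F'[OF B] by blast
        have "matrix_inv B *v (B *v v) = v"
          using SL(5)[OF B] by (simp add: matrix_vector_mul_assoc)
        then have "c \<noteq> 0" using \<open>v \<noteq> 0\<close> f(2) by auto
        have "congr_mat (transpose B) (outer v v) = (c * c) *\<^sub>R outer f f"
          unfolding congr_mat_outer transpose_transpose f(2) by (rule outer_scaleR)
        then show ?thesis
          using \<open>c \<noteq> 0\<close> f(1) by (simp add: congr_mat_image_span span_singleton_scaleR)
      qed
      then have "(\<lambda>B. congr_mat (transpose B) ` span {outer v v}) ` G \<subseteq> (\<lambda>f. span {outer f f}) ` F'"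
        by blast
      then have "finite ((\<lambda>B. congr_mat (transpose B) ` span {outer v v}) ` G)"
        by (rule finite_subset) (simp add: F'_def nF(2))
      then show ?thesis
        using outer_self_nonzero[OF \<open>v \<noteq> 0\<close>] transpose_outer[of v v] by blast
    qed
  qed
qed

section \<open>Invariant spaces of forms\<close>

text \<open>\<open>W\<close> stands for a space of forms but consists of all matrices representing
  them, hence contains the skew ones. A matrix orthogonal to \<open>W\<close> is then automatically
  symmetric and defines a conic.\<close>

lemma SL3_subgroup_invariant_subspace:
  fixes G :: "(real^3^3) set"
  assumes G: "subgroup G SL" and W: "subspace W" "W \<noteq> UNIV"
    and skew: "\<And>S. transpose S = - S \<Longrightarrow> S \<in> W"
    and T: "T \<in> W" "transpose T = T" "T \<noteq> 0"
    and inva: "\<And>B S. B \<in> G \<Longrightarrow> S \<in> W \<Longrightarrow> congr_mat B S \<in> W"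
  shows "\<exists>Q. transpose Q = Q \<and> Q \<noteq> 0 \<and>
    (finite ((\<lambda>B. congr_mat B ` span {Q}) ` G) \<or> finite ((\<lambda>B. congr_mat (transpose B) ` span {Q}) ` G))"
proof (cases "bounded G")
  case True
  obtain S where S: "transpose S = S" "S \<noteq> 0" "\<forall>B\<in>G. congr_mat B S = S"
    using bounded_SL_subgroup_fixes_form[OF G True] by blast
  then have "(\<lambda>B. congr_mat B ` span {S}) ` G \<subseteq> {span {S}}"
    by (auto simp: congr_mat_image_span)
  then have "finite ((\<lambda>B. congr_mat B ` span {S}) ` G)"
    by (rule finite_subset) simp
  then show ?thesis
    using S(1,2) by blast
next
  case False
  note SL = SL_subgroupD[OF G]
  obtain B s v w where B: "\<And>n :: nat. B n \<in> G" "v \<noteq> 0" "w \<noteq> 0" "(\<lambda>n. s n *\<^sub>R B n) \<longlonglongrightarrow> outer v w"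
    by (rule unbounded_SL3_subgroup_rank_one_limit[OF G False]) blast
  show ?thesis
  proof (cases "\<forall>A\<in>G. (A *v v) \<bullet> (T *v (A *v v)) = 0")
    case True
    then show ?thesis
      using orbit_on_conic[OF G B(2) T(2,3)] by blast
  next
    case False
    then obtain A where A: "A \<in> G" "(A *v v) \<bullet> (T *v (A *v v)) \<noteq> 0" by blast
    \<comment> \<open>\<open>A\<close> carries \<open>T\<close> to a member of \<open>W\<close> that
      does not vanish at \<open>v\<close>, so its rescaled limit is a nonzero multiple of
      \<open>outer w w\<close>.\<close>
    define S where "S = congr_mat A T"
    have "S \<in> W" using inva A(1) T(1) by (simp add: S_def)
    have lim: "(\<lambda>n. congr_mat (s n *\<^sub>R B n) S) \<longlonglongrightarrow> congr_mat (outer v w) S"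
    proof -
      have bb: "bounded_bilinear ((**) :: real^3^3 \<Rightarrow> real^3^3 \<Rightarrow> real^3^3)"
        by (rule bilinear_matrix_mult[unfolded bilinear_conv_bounded_bilinear])
      have "(\<lambda>n. transpose (s n *\<^sub>R B n)) \<longlonglongrightarrow> transpose (outer v w)"
        unfolding transpose_def by (intro tendsto_vec_lambda tendsto_vec_nth B(4))
      then show ?thesis
        unfolding congr_mat_def by (intro bounded_bilinear.tendsto[OF bb] tendsto_const B(4))
    qed
    have "congr_mat (s n *\<^sub>R B n) S \<in> W" for n
      using inva[OF B(1) \<open>S \<in> W\<close>] W(1) by (simp add: congr_mat_scaleR subspace_scale)
    then have "congr_mat (outer v w) S \<in> W"
      by (rule closed_sequentially[OF closed_subspace[OF W(1)] _ lim])
    moreover have "v \<bullet> (S *v v) \<noteq> 0"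
      using A(2) by (simp add: S_def inner_congr_mat_vector)
    ultimately have "outer w w \<in> W"
      using subspace_scale[OF W(1), of "congr_mat (outer v w) S" "1 / (v \<bullet> (S *v v))"]
      by (simp add: congr_mat_outer_rank_one)
    have "span W = W"
      using W(1) by simp
    then have "span W \<subset> span UNIV"
      unfolding \<open>span W = W\<close> span_UNIV using W(2) by blast
    then obtain Q where Q: "Q \<noteq> 0" "Q \<in> span UNIV" "\<And>S. S \<in> span W \<Longrightarrow> orthogonal Q S"
      by (rule orthogonal_to_subspace_exists_gen) blast
    note QW = Q(3)[unfolded \<open>span W = W\<close>]
    \<comment> \<open>Orthogonality of \<open>Q\<close> to this skew matrix forces it to be
      zero.\<close>
    have "Q - transpose Q \<in> W"
      by (rule skew) (simp add: transpose_def vec_eq_iff)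
    then have "Q \<bullet> Q = Q \<bullet> transpose Q"
      using QW[of "Q - transpose Q"] by (simp add: orthogonal_def inner_diff_right)
    then have "(Q - transpose Q) \<bullet> (Q - transpose Q) = 0"
      using inner_transpose[of Q Q]
      by (simp add: inner_diff_left inner_diff_right inner_commute)
    then have "transpose Q = Q" by simp
    have "(C *v w) \<bullet> (Q *v (C *v w)) = 0" if C: "C \<in> transpose ` G" for C
    proof -
      obtain C' where C': "C = transpose C'" "C' \<in> G" using C by blast
      have "congr_mat C' (outer w w) \<in> W"
        using inva C'(2) \<open>outer w w \<in> W\<close> by blast
      then have "orthogonal Q (congr_mat C' (outer w w))"
        by (rule QW)
      then have "Q \<bullet> outer (C *v w) (C *v w) = 0"
        by (simp only: congr_mat_outer C'(1) orthogonal_def)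
      then show ?thesis
        by (simp add: inner_outer)
    qed
    \<comment> \<open>For the transposed group the two alternatives of the conclusion change
      places.\<close>
    from orbit_on_conic[OF subgroup_transpose_SL[OF G] B(3) \<open>transpose Q = Q\<close> Q(1) this]
    show ?thesis
      by (simp add: image_image) blast
  qed
qed

section \<open>Quadratic forms as symmetric matrices\<close>

lemma bilinear_form_matrix:
  fixes B :: "real^'n \<Rightarrow> real^'n \<Rightarrow> real"
  assumes "bilinear B"
  obtains S where "\<And>x y. B x y = x \<bullet> (S *v y)"
proof
  fix x y
  define f where "f y = (\<chi> i. B (axis i 1) y)" for y
  have "linear f"
    using assms by (auto simp: f_def bilinear_def linear_iff vec_eq_iff)
  have lin: "linear (\<lambda>x. B x y)"
    using assms by (simp add: bilinear_def)
  have "B x y = B (\<Sum>i\<in>UNIV. x $ i *\<^sub>R axis i 1) y"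
    using basis_expansion[of x] by (simp add: scalar_mult_eq_scaleR)
  also have "\<dots> = (\<Sum>i\<in>UNIV. x $ i * B (axis i 1) y)"
    by (simp add: linear_sum[OF lin] linear_scale[OF lin])
  also have "\<dots> = x \<bullet> (matrix f *v y)"
    using fun_cong[OF matrix_vector_mul(2)[OF \<open>linear f\<close>], of y] by (simp add: f_def inner_vec_def)
  finally show "B x y = x \<bullet> (matrix (\<lambda>y. \<chi> i. B (axis i 1) y) *v y)"
    by (simp add: f_def[abs_def])
qed

text \<open>Arbitrary matrices are allowed, so that the map is linear on the full matrix space; its
  kernel consists of the skew matrices.\<close>

lift_definition form_of_mat :: "real^'n^'n \<Rightarrow> (real^'n) quadratic_form" is "\<lambda>S x. x \<bullet> (S *v x)"
proof -
  fix S :: "real^'n^'n"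
  show "\<exists>B. bilinear B \<and> (\<lambda>x. x \<bullet> (S *v x)) = (\<lambda>x. B x x)"
    by (intro exI[of _ "\<lambda>x y. x \<bullet> (S *v y)"])
      (simp add: bilinear_def linear_iff inner_add_left inner_add_right matrix_vector_right_distrib
        matrix_vector_mult_scaleR)
qed

text \<open>The vector representing a functional through the inner product. Precomposition with
  \<open>A\<close> becomes multiplication by its transpose.\<close>

definition functional_vec :: "((real^'n) \<Rightarrow>\<^sub>L real) \<Rightarrow> real^'n" where
  "functional_vec \<xi> = (\<chi> i. \<xi> (axis i 1))"

lemma linear_functional_vec: "linear functional_vec"
  by (auto simp: linear_iff functional_vec_def vec_eq_iff blinfun.add_left blinfun.scaleR_left)

lemma inner_functional_vec: "functional_vec \<xi> \<bullet> x = \<xi> x"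
proof -
  have "\<xi> x = \<xi> (\<Sum>i\<in>UNIV. x $ i *\<^sub>R axis i 1)"
    using basis_expansion[of x] by (simp add: scalar_mult_eq_scaleR)
  also have "\<dots> = (\<Sum>i\<in>UNIV. x $ i * \<xi> (axis i 1))"
    by (simp add: blinfun.sum_right blinfun.scaleR_right)
  finally show ?thesis
    by (simp add: functional_vec_def inner_vec_def mult.commute)
qed

lemma functional_vec_inner: "functional_vec (blinfun_inner_right v) = v"
  by (simp add: functional_vec_def vec_eq_iff inner_axis)

lemma blinfun_inner_functional_vec: "blinfun_inner_right (functional_vec \<xi>) = \<xi>"
  by (rule blinfun_eqI) (simp add: inner_functional_vec)

lemma functional_vec_compose: "functional_vec (\<xi> o\<^sub>L Blinfun ((*v) A)) = transpose A *v functional_vec \<xi>"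
proof -
  have "functional_vec (\<xi> o\<^sub>L Blinfun ((*v) A)) \<bullet> x = (transpose A *v functional_vec \<xi>) \<bullet> x" for x
    by (simp add: inner_functional_vec dot_lmul_matrix bounded_linear_Blinfun_apply)
  then show ?thesis
    by (metis vector_eq_rdot)
qed

lift_definition dual_form_of_mat :: "real^'n^'n \<Rightarrow> ((real^'n) \<Rightarrow>\<^sub>L real) quadratic_form"
  is "\<lambda>Q \<xi>. functional_vec \<xi> \<bullet> (Q *v functional_vec \<xi>)"
proof -
  fix Q :: "real^'n^'n"
  show "\<exists>B. bilinear B \<and> (\<lambda>\<xi>. functional_vec \<xi> \<bullet> (Q *v functional_vec \<xi>)) = (\<lambda>x. B x x)"
    by (intro exI[of _ "\<lambda>\<xi> \<eta>. functional_vec \<xi> \<bullet> (Q *v functional_vec \<eta>)"])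
      (simp add: bilinear_def linear_iff inner_add_left inner_add_right matrix_vector_right_distrib
        matrix_vector_mult_scaleR linear_add[OF linear_functional_vec] linear_scale[OF linear_functional_vec])
qed

lemma linear_form_of_mat: "linear form_of_mat"
  by (rule linearI; transfer)
    (auto simp: matrix_vector_mult_add_rdistrib inner_add_right simp flip: scaleR_matrix_vector_assoc)

lemma linear_dual_form_of_mat: "linear dual_form_of_mat"
  by (rule linearI; transfer)
    (auto simp: matrix_vector_mult_add_rdistrib inner_add_right simp flip: scaleR_matrix_vector_assoc)

lemma symmetric_part:
  fixes S :: "real^'n^'n"
  obtains T where "transpose T = T" "\<And>x. x \<bullet> (T *v x) = x \<bullet> (S *v x)"
proof
  let ?T = "(1/2) *\<^sub>R (S + transpose S)"
  show "transpose ?T = ?T"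
    by (simp add: vec_eq_iff transpose_def)
  have "x \<bullet> (x v* S) = x \<bullet> (S *v x)" for x
    by (metis dot_lmul_matrix inner_commute)
  then show "x \<bullet> (?T *v x) = x \<bullet> (S *v x)" for x
    by (simp add: matrix_vector_mult_add_rdistrib inner_add_right flip: scaleR_matrix_vector_assoc)
qed

lemma form_of_mat_surj:
  obtains S where "transpose S = S" "q = form_of_mat S"
proof -
  obtain B where B: "bilinear B" "form_at q = (\<lambda>x. B x x)"
    using form_at[of q] by blast
  obtain S where S: "\<And>x y. B x y = x \<bullet> (S *v y)"
    using bilinear_form_matrix[OF B(1)] by blast
  obtain T where "transpose T = T" "\<And>x. x \<bullet> (T *v x) = x \<bullet> (S *v x)"
    using symmetric_part[of S] by blast
  then show thesis
    using B(2) S by (intro that[of T] form_at_inject[THEN iffD1] ext) (simp_all add: form_of_mat.rep_eq)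
qed

text \<open>The inner product turns a form on functionals into one on vectors, where the matrix
  description applies.\<close>

lemma dual_form_of_mat_surj:
  obtains Q where "transpose Q = Q" "q = dual_form_of_mat Q"
proof -
  obtain B where B: "bilinear B" "form_at q = (\<lambda>x. B x x)"
    using form_at[of q] by blast
  have "bilinear (\<lambda>x y. B (blinfun_inner_right x) (blinfun_inner_right y))"
  proof -
    have "blinfun_inner_right (x + y) = blinfun_inner_right x + blinfun_inner_right y"
      "blinfun_inner_right (c *\<^sub>R x) = c *\<^sub>R blinfun_inner_right x" for x y :: "real^'a" and c
      by (rule blinfun_eqI, simp add: inner_add_left blinfun.add_left blinfun.scaleR_left)+
    then show ?thesis
      using B(1) by (simp add: bilinear_def linear_iff)
  qed
  then obtain S where S: "\<And>x y. B (blinfun_inner_right x) (blinfun_inner_right y) = x \<bullet> (S *v y)"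
    using bilinear_form_matrix by blast
  obtain T where T: "transpose T = T" "\<And>x. x \<bullet> (T *v x) = x \<bullet> (S *v x)"
    using symmetric_part[of S] by blast
  show thesis
  proof (rule that[of T])
    have "form_at q \<xi> = functional_vec \<xi> \<bullet> (T *v functional_vec \<xi>)" for \<xi>
      using S[of "functional_vec \<xi>" "functional_vec \<xi>"] B(2) T(2)
      by (simp add: blinfun_inner_functional_vec)
    then show "q = dual_form_of_mat T"
      by (intro form_at_inject[THEN iffD1] ext) (simp add: dual_form_of_mat.rep_eq)
  qed (fact T(1))
qed

text \<open>The symmetrised difference is a symmetric matrix whose form vanishes, so polarisation
  applies.\<close>

lemma symmetric_part_eqI:
  fixes S T :: "real^'n^'n"
  assumes "\<And>x. x \<bullet> (S *v x) = x \<bullet> (T *v x)"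
  shows "S + transpose S = T + transpose T"
proof -
  have "(S - T) + transpose (S - T) = 0"
  proof (rule symmetric_mat_eq_0)
    fix x
    have "x \<bullet> (x v* (S - T)) = x \<bullet> ((S - T) *v x)"
      by (metis dot_lmul_matrix inner_commute)
    then show "x \<bullet> (((S - T) + transpose (S - T)) *v x) = 0"
      using assms[of x] by (simp add: matrix_vector_mult_add_rdistrib matrix_vector_mult_diff_rdistrib inner_add_right inner_diff_right)
  qed (simp add: transpose_def vec_eq_iff)
  then show ?thesis
    by (simp add: vec_eq_iff transpose_def algebra_simps)
qed

lemma form_of_mat_eq_iff: "form_of_mat S = form_of_mat T \<longleftrightarrow> S + transpose S = T + transpose T"
proof
  assume "form_of_mat S = form_of_mat T"
  then have "x \<bullet> (S *v x) = x \<bullet> (T *v x)" for x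
    by (metis form_of_mat.rep_eq)
  then show "S + transpose S = T + transpose T"
    by (rule symmetric_part_eqI)
next
  assume *: "S + transpose S = T + transpose T"
  have "x \<bullet> ((R + transpose R) *v x) = 2 * (x \<bullet> (R *v x))" for x and R :: "real^'a^'a"
    using dot_lmul_matrix[of x R x] by (simp add: matrix_vector_mult_add_rdistrib inner_add_right inner_commute)
  from this[of _ S] this[of _ T] have "x \<bullet> (S *v x) = x \<bullet> (T *v x)" for x
    unfolding * by (metis mult_cancel_left zero_neq_numeral)
  then show "form_of_mat S = form_of_mat T"
    by (intro form_at_inject[THEN iffD1] ext) (simp add: form_of_mat.rep_eq)
qed

lemma symmetric_form_of_mat_inject:
  assumes "transpose S = S" "transpose T = T"
  shows "form_of_mat S = form_of_mat T \<longleftrightarrow> S = T"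
  unfolding form_of_mat_eq_iff assms by (simp flip: scaleR_2)

lemma symmetric_dual_form_of_mat_inject:
  assumes "transpose S = S" "transpose T = T"
  shows "dual_form_of_mat S = dual_form_of_mat T \<longleftrightarrow> S = T"
proof
  assume *: "dual_form_of_mat S = dual_form_of_mat T"
  have "x \<bullet> (S *v x) = x \<bullet> (T *v x)" for x
    using arg_cong[OF *, of "\<lambda>q. form_at q (blinfun_inner_right x)"]
    by (simp add: dual_form_of_mat.rep_eq functional_vec_inner)
  then have "S + transpose S = T + transpose T"
    by (rule symmetric_part_eqI)
  then show "S = T"
    unfolding assms by (simp flip: scaleR_2)
qed simp

text \<open>Forms are pulled back along the inverse of \<open>A\<close>. Dual forms are instead
  evaluated on functionals precomposed with \<open>A\<close>, whence the transpose in the companion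
  formula.\<close>

lemma form_rep_form_of_mat: "form_rep A (form_of_mat S) = form_of_mat (congr_mat (matrix_inv A) S)"
  by (intro form_at_inject[THEN iffD1] ext)
    (simp add: form_rep.rep_eq form_of_mat.rep_eq inner_congr_mat_vector)

lemma dual_form_rep_dual_form_of_mat:
  "dual_form_rep A (dual_form_of_mat Q) = dual_form_of_mat (congr_mat (transpose A) Q)"
  by (intro form_at_inject[THEN iffD1] ext)
    (simp add: dual_form_rep.rep_eq dual_form_of_mat.rep_eq inner_congr_mat_vector functional_vec_compose
      del: transpose_matrix_vector)

lemma form_of_mat_image_span: "form_of_mat ` span {S} = span {form_of_mat S}"
  using linear_span_image[OF linear_form_of_mat, of "{S}"] by simp

lemma dual_form_of_mat_image_span: "dual_form_of_mat ` span {S} = span {dual_form_of_mat S}"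
  using linear_span_image[OF linear_dual_form_of_mat, of "{S}"] by simp

section \<open>Apolarity between conics and dual conics\<close>

text \<open>The annihilator of \<open>p\<close> under the pairing of the two symmetric squares. For
  a projective point \<open>p\<close> it is a hyperplane, classically the conics apolar to a dual
  conic.\<close>

definition apolar :: "((real^'n) \<Rightarrow>\<^sub>L real) quadratic_form set \<Rightarrow> (real^'n) quadratic_form set" where
  "apolar p = form_of_mat ` {S. \<forall>Q. transpose Q = Q \<longrightarrow> dual_form_of_mat Q \<in> p \<longrightarrow> Q \<bullet> S = 0}"

lemma subspace_apolar: "subspace (apolar p)"
  unfolding apolar_def
  by (intro linear_subspace_image[OF linear_form_of_mat]) (simp add: subspace_def inner_add_right)

text \<open>Congruence by the inverse on one side and by the transpose on the other cancel in the
  pairing, which gives one inclusion for every \<open>A\<close>. Applied to the inverse matrix, it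
  yields the other.\<close>

lemma form_rep_image_apolar:
  assumes "A \<in> carrier SL"
  shows "form_rep A ` apolar p = apolar (dual_form_rep A ` p)"
proof
  have sub: "form_rep A ` apolar p \<subseteq> apolar (dual_form_rep A ` p)" if A: "A \<in> carrier SL"
    for A :: "real^'n^'n" and p
  proof -
    have "form_rep A (form_of_mat S) \<in> apolar (dual_form_rep A ` p)"
      if S: "\<And>Q. transpose Q = Q \<Longrightarrow> dual_form_of_mat Q \<in> p \<Longrightarrow> Q \<bullet> S = 0" for S
      unfolding form_rep_form_of_mat apolar_def
    proof (intro imageI CollectI allI impI)
      fix Q' assume Q': "transpose Q' = Q'" "dual_form_of_mat Q' \<in> dual_form_rep A ` p"
      then obtain q where q: "q \<in> p" "dual_form_of_mat Q' = dual_form_rep A q" by blast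
      obtain Q where Q: "transpose Q = Q" "q = dual_form_of_mat Q"
        by (rule dual_form_of_mat_surj)
      have "dual_form_of_mat Q' = dual_form_of_mat (congr_mat (transpose A) Q)"
        using q Q by (simp add: dual_form_rep_dual_form_of_mat)
      then have "Q' = congr_mat (transpose A) Q"
        using Q'(1) Q(1) by (simp add: symmetric_dual_form_of_mat_inject transpose_congr_mat)
      then have "Q' \<bullet> congr_mat (matrix_inv A) S = congr_mat (transpose A ** transpose (matrix_inv A)) Q \<bullet> S"
        by (simp add: inner_congr_mat congr_mat_mult)
      also have "transpose A ** transpose (matrix_inv A) = mat 1"
        using SL_matrix_inv(2)[OF A] by (simp flip: matrix_transpose_mul)
      finally show "Q' \<bullet> congr_mat (matrix_inv A) S = 0"
        using S[OF Q(1)] q(1) Q(2) by simp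
    qed
    then show ?thesis
      unfolding apolar_def[of p] by blast
  qed
  show "form_rep A ` apolar p \<subseteq> apolar (dual_form_rep A ` p)"
    by (rule sub[OF assms])
  have inv: "matrix_inv A \<in> carrier SL"
    using SL_subgroupD(3)[OF group.subgroup_self[OF group_SL] assms] .
  have "form_rep (matrix_inv A) ` apolar (dual_form_rep A ` p) \<subseteq> apolar (dual_form_rep (matrix_inv A) ` dual_form_rep A ` p)"
    by (rule sub[OF inv])
  also have "dual_form_rep (matrix_inv A) ` dual_form_rep A ` p = p"
    using SL_matrix_inv(2)[OF assms] by (simp add: image_comp dual_form_rep_one flip: dual_form_rep_mult)
  finally have "form_rep A ` form_rep (matrix_inv A) ` apolar (dual_form_rep A ` p) \<subseteq> form_rep A ` apolar p"
    by (rule image_mono)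
  moreover have "form_rep A ` form_rep (matrix_inv A) ` X = X" for X
    using SL_matrix_inv(1)[OF assms] by (simp add: image_comp form_rep_one flip: form_rep_mult[OF assms inv])
  ultimately show "apolar (dual_form_rep A ` p) \<subseteq> form_rep A ` apolar p"
    by simp
qed

text \<open>With \<open>Q\<close> spanning \<open>p\<close>, two diagonal unit matrices already have
  a nonzero combination orthogonal to \<open>Q\<close>, while the form of \<open>Q\<close> itself is
  not apolar because \<open>Q \<bullet> Q\<close> is positive.\<close>

lemma apolar_proper:
  fixes p :: "((real^3) \<Rightarrow>\<^sub>L real) quadratic_form set"
  assumes "p \<in> proj_space"
  shows "apolar p \<noteq> {0}" "apolar p \<noteq> UNIV"
proof -
  obtain q where q: "q \<noteq> 0" "p = span {q}"
    using assms by (auto simp: proj_space_def)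
  obtain Q where Q: "transpose Q = Q" "q = dual_form_of_mat Q"
    by (rule dual_form_of_mat_surj)
  have "Q \<noteq> 0"
  proof
    assume "Q = 0"
    then have "q = 0"
      unfolding Q(2) by (simp only: linear_0[OF linear_dual_form_of_mat])
    with q(1) show False ..
  qed
  have p: "Q' \<in> span {Q}" if Q': "transpose Q' = Q'" "dual_form_of_mat Q' \<in> p" for Q'
  proof -
    obtain c where "dual_form_of_mat Q' = c *\<^sub>R dual_form_of_mat Q"
      using Q'(2) unfolding q(2) Q(2) span_singleton by blast
    also have "\<dots> = dual_form_of_mat (c *\<^sub>R Q)"
      by (simp add: linear_scale[OF linear_dual_form_of_mat])
    finally have "Q' = c *\<^sub>R Q"
      using Q'(1) Q(1) by (simp add: symmetric_dual_form_of_mat_inject transpose_scalar)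
    then show ?thesis by (auto simp: span_singleton)
  qed
  define E where "E = (\<lambda>i :: 3. outer (axis i 1) (axis i 1 :: real^3))"
  \<comment> \<open>In the second case the coefficient of \<open>E 2\<close> is
    \<open>- (Q \<bullet> E 1)\<close>, so \<open>S\<close> is nonzero in both cases.\<close>
  define S where "S = (if Q \<bullet> E 1 = 0 then E 1 else (Q \<bullet> E 2) *\<^sub>R E 1 - (Q \<bullet> E 1) *\<^sub>R E 2)"
  have E: "E i $ a $ b = (if a = i \<and> b = i then 1 else 0)" "transpose (E i) = E i" for i a b
    by (auto simp: E_def transpose_outer) (auto simp: outer_def axis_def)
  have "S $ 1 $ 1 \<noteq> 0 \<or> S $ 2 $ 2 \<noteq> 0"
    by (simp add: S_def E(1))
  moreover have "transpose S = S"
  proof -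
    have "transpose (a *\<^sub>R A - b *\<^sub>R B) = a *\<^sub>R transpose A - b *\<^sub>R transpose B" for a b and A B :: "real^3^3"
      by (simp add: transpose_def vec_eq_iff)
    then show ?thesis
      by (simp add: S_def E(2))
  qed
  moreover have "transpose 0 = (0 :: real^3^3)"
    by (simp add: transpose_def vec_eq_iff)
  ultimately have "form_of_mat S \<noteq> form_of_mat 0"
    using symmetric_form_of_mat_inject[of S 0] by auto
  have "Q \<bullet> S = 0"
    by (simp add: S_def inner_diff_right)
  have "form_of_mat S \<in> apolar p"
    unfolding apolar_def
  proof (intro imageI CollectI allI impI)
    fix R assume "transpose R = R" "dual_form_of_mat R \<in> p"
    then obtain c where "R = c *\<^sub>R Q"
      using p[of R] unfolding span_singleton by blast
    then show "R \<bullet> S = 0"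
      using \<open>Q \<bullet> S = 0\<close> by simp
  qed
  moreover have "form_of_mat S \<noteq> 0"
    using \<open>form_of_mat S \<noteq> form_of_mat 0\<close> unfolding linear_0[OF linear_form_of_mat] .
  ultimately show "apolar p \<noteq> {0}"
    by blast
  show "apolar p \<noteq> UNIV"
  proof
    assume "apolar p = UNIV"
    then have "form_of_mat Q \<in> apolar p" by simp
    then obtain T where T: "form_of_mat Q = form_of_mat T"
      "\<And>R. transpose R = R \<Longrightarrow> dual_form_of_mat R \<in> p \<Longrightarrow> R \<bullet> T = 0"
      unfolding apolar_def by blast
    have "Q \<bullet> T = 0"
    proof (rule T(2)[OF Q(1)])
      show "dual_form_of_mat Q \<in> p"
        unfolding q(2) Q(2) by (rule span_base) simp
    qed
    \<comment> \<open>\<open>T\<close> is determined only up to a skew matrix, and pairing with the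
      symmetric \<open>Q\<close> does not see this ambiguity.\<close>
    have "Q \<bullet> transpose T = Q \<bullet> T"
      using inner_transpose[of Q T] Q(1) by simp
    moreover have "Q + transpose Q = T + transpose T"
      using T(1) by (simp only: form_of_mat_eq_iff)
    ultimately have "Q \<bullet> (Q + transpose Q) = 0"
      using \<open>Q \<bullet> T = 0\<close> by (simp only: inner_add_right)
    then have "Q \<bullet> Q = 0"
      unfolding Q(1) inner_add_right by simp
    then show False
      using \<open>Q \<noteq> 0\<close> by simp
  qed
qed

text \<open>If one form spanned everything, the squares of the first two coordinates would be
  proportional; evaluation at coordinate vectors refutes this.\<close>

lemma conic_point_proper:
  fixes p :: "(real^3) quadratic_form set"
  assumes "p \<in> proj_space"
  shows "p \<noteq> {0}" "p \<noteq> UNIV"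
proof -
  obtain q where q: "q \<noteq> 0" "p = span {q}"
    using assms by (auto simp: proj_space_def)
  show "p \<noteq> {0}"
    using span_base[of q "{q}"] q by blast
  show "p \<noteq> UNIV"
  proof
    assume "p = UNIV"
    define E where "E = (\<lambda>i :: 3. form_of_mat (outer (axis i 1) (axis i 1 :: real^3)))"
    have E: "form_at (E i) (axis j 1) = (if i = j then 1 else 0)" for i j
      unfolding E_def form_of_mat.rep_eq outer_matrix_vector_mult inner_scaleR_right inner_axis_axis
      by simp
    have ex: "\<exists>c. \<forall>x. form_at (E i) x = c * form_at q x" for i
    proof -
      have "E i \<in> span {q}"
        using \<open>p = UNIV\<close> q(2) by blast
      then obtain c where "E i = c *\<^sub>R q"
        unfolding span_singleton by blast
      then show ?thesis
        by (auto simp: scaleR_quadratic_form.rep_eq)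
    qed
    obtain a b where "\<And>x. form_at (E 1) x = a * form_at q x" "\<And>x. form_at (E 2) x = b * form_at q x"
      using ex[of 1] ex[of 2] by blast
    then show False
      using E[of 1 1] E[of 2 1] E[of 2 2] by auto
  qed
qed

section \<open>From PSL to matrices\<close>

text \<open>The only real cube root of one is one. Hence the cosets that make up PSL are singletons
  and can be treated as matrices.\<close>

lemma SL3_center: "{A \<in> carrier SL. \<exists>c. A = mat c} = {mat 1 :: real^3^3}"
  using SL3_scalar by (auto simp: SL_def)

lemma PSL3_carrier: "carrier PSL = (\<lambda>A. {A}) ` carrier (SL :: (real^3^3) monoid)"
  unfolding PSL_def carrier_FactGroup SL3_center
  by (intro image_cong refl) (simp add: r_coset_def SL_def)

lemma PSL3_mult: "{A} \<otimes>\<^bsub>PSL\<^esub> {B} = {A ** B :: real^3^3}"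
  by (simp add: PSL_def mult_FactGroup set_mult_def SL_def)

lemma PSL3_one: "\<one>\<^bsub>PSL\<^esub> = {mat 1 :: real^3^3}"
  unfolding PSL_def one_FactGroup SL3_center ..

section \<open>Orbits under representations of SL(3)\<close>

text \<open>Conics and dual conics satisfy the same axioms, so finite orbits and virtually fixed
  points are treated once for both.\<close>

locale SL3_representation =
  fixes \<rho> :: "real^3^3 \<Rightarrow> 'v::real_vector \<Rightarrow> 'v"
  assumes linear: "linear (\<rho> A)"
    and one: "\<rho> (mat 1) = id"
    and mult: "A \<in> carrier SL \<Longrightarrow> B \<in> carrier SL \<Longrightarrow> \<rho> (A ** B) = \<rho> A \<circ> \<rho> B"
begin

text \<open>The matrix is extracted from its singleton coset. A plain image replaces the union over
  representatives in \<open>proj_act\<close>; the two agree on subspaces.\<close>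

definition act :: "(real^3^3) set \<Rightarrow> 'v set \<Rightarrow> 'v set" where
  "act g X = \<rho> (the_elem g) ` X"

lemma act_singleton: "act {A} X = \<rho> A ` X"
  by (simp add: act_def)

lemma act_mult:
  assumes "g \<in> carrier PSL" "h \<in> carrier PSL"
  shows "act (g \<otimes>\<^bsub>PSL\<^esub> h) X = act g (act h X)"
  using assms by (auto simp: PSL3_carrier PSL3_mult act_singleton mult)

lemma act_one: "act \<one>\<^bsub>PSL\<^esub> X = X"
  by (simp add: PSL3_one act_singleton one)

lemma subspace_act: "subspace X \<Longrightarrow> subspace (act g X)"
  unfolding act_def by (rule linear_subspace_image[OF linear])

lemma proj_act_eq_act:
  assumes "g \<in> carrier PSL" and "subspace X"
  shows "proj_act (proj_rep \<rho> g) X = act g X"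
proof -
  obtain A where A: "A \<in> carrier SL" "g = {A}"
    using assms(1) by (auto simp: PSL3_carrier)
  have "proj_rep \<rho> ({Z \<in> carrier SL. \<exists>c. Z = mat c} #>\<^bsub>SL\<^esub> A) = scalar_maps #>\<^bsub>GL\<^esub> \<rho> A"
    by (rule proj_rep_coset[OF hom_SL_GL_I[OF linear one mult] _ A(1)])
      (auto dest!: SL3_scalar simp: one id_in_scalar_maps[unfolded id_def] id_def)
  moreover have "{Z \<in> carrier SL. \<exists>c. Z = mat c} #>\<^bsub>SL\<^esub> A = g"
    by (simp add: SL3_center r_coset_def A(2)) (simp add: SL_def)
  ultimately have "proj_rep \<rho> g = scalar_maps #>\<^bsub>GL\<^esub> \<rho> A"
    by (simp only:)
  then show ?thesis
    using proj_act_coset[OF assms(2) linear] by (simp add: A(2) act_singleton)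
qed

lemma act_inv:
  assumes "g \<in> carrier PSL"
  shows "act g (act (inv\<^bsub>PSL\<^esub> g) X) = X" "act (inv\<^bsub>PSL\<^esub> g) (act g X) = X"
proof -
  interpret group "PSL :: (real^3^3) set monoid" by (rule group_PSL)
  show "act g (act (inv\<^bsub>PSL\<^esub> g) X) = X" "act (inv\<^bsub>PSL\<^esub> g) (act g X) = X"
    using assms act_one by (simp_all add: act_mult[symmetric])
qed

context
  fixes \<Gamma> :: "(real^3^3) set set"
  assumes \<Gamma>: "subgroup \<Gamma> PSL"
begin

lemma group_\<Gamma>: "group (PSL\<lparr>carrier := \<Gamma>\<rparr>)"
  using subgroup.subgroup_is_group[OF \<Gamma> group_PSL] .

lemma act_mult_\<Gamma>: "g \<in> carrier (PSL\<lparr>carrier := \<Gamma>\<rparr>) \<Longrightarrow> h \<in> carrier (PSL\<lparr>carrier := \<Gamma>\<rparr>) \<Longrightarrow>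
    act (g \<otimes>\<^bsub>PSL\<lparr>carrier := \<Gamma>\<rparr>\<^esub> h) X = act g (act h X)"
  using subgroup.mem_carrier[OF \<Gamma>] by (simp add: act_mult)

lemma finite_index_finite_orbit:
  assumes "finite_index_subgroup H \<Gamma> PSL" and "finite ((\<lambda>h. act h X) ` H)"
  shows "finite ((\<lambda>g. act g X) ` \<Gamma>)"
  using finite_orbit_of_finite_index[OF group_\<Gamma>, of H act X] act_mult_\<Gamma> assms
  by (simp add: finite_index_subgroup_def)

lemma finite_orbit_finite_index:
  assumes "finite ((\<lambda>g. act g X) ` \<Gamma>)"
  shows "finite_index_subgroup {g \<in> \<Gamma>. act g X = X} \<Gamma> PSL"
  using finite_index_stabiliser[OF group_\<Gamma>, of act X] act_mult_\<Gamma> act_one assms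
  by (simp add: finite_index_subgroup_def)

text \<open>One direction spreads the one-point orbit of \<open>H\<close> over finitely many cosets;
  the other takes the stabiliser of \<open>p\<close> as \<open>H\<close>.\<close>

lemma virtually_fixed_point_iff:
  "(\<exists>H. finite_index_subgroup H \<Gamma> PSL \<and> (\<exists>p\<in>proj_space. \<forall>h\<in>H. proj_act (proj_rep \<rho> h) p = p)) \<longleftrightarrow>
   (\<exists>p\<in>proj_space. finite ((\<lambda>g. act g p) ` \<Gamma>))"
proof -
  have sub: "subspace p" if "p \<in> proj_space" for p :: "'v set"
    using that by (auto simp: proj_space_def)
  show ?thesis
  proof
    assume "\<exists>H. finite_index_subgroup H \<Gamma> PSL \<and> (\<exists>p\<in>proj_space. \<forall>h\<in>H. proj_act (proj_rep \<rho> h) p = p)"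
    then obtain H p where H: "finite_index_subgroup H \<Gamma> PSL" "p \<in> proj_space"
      "\<And>h. h \<in> H \<Longrightarrow> proj_act (proj_rep \<rho> h) p = p" by blast
    have "H \<subseteq> \<Gamma>"
      using H(1) subgroup.subset[of H "PSL\<lparr>carrier := \<Gamma>\<rparr>"] by (simp add: finite_index_subgroup_def)
    then have "act h p = p" if "h \<in> H" for h
      using H(3)[OF that] proj_act_eq_act[of h p] sub[OF H(2)] that subgroup.mem_carrier[OF \<Gamma>] by auto
    then have "(\<lambda>h. act h p) ` H \<subseteq> {p}" by blast
    then have "finite ((\<lambda>h. act h p) ` H)" by (rule finite_subset) simp
    then show "\<exists>p\<in>proj_space. finite ((\<lambda>g. act g p) ` \<Gamma>)"
      using finite_index_finite_orbit[OF H(1)] H(2) by blast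
  next
    assume "\<exists>p\<in>proj_space. finite ((\<lambda>g. act g p) ` \<Gamma>)"
    then obtain p where p: "p \<in> proj_space" "finite ((\<lambda>g. act g p) ` \<Gamma>)" by blast
    have "proj_act (proj_rep \<rho> h) p = p" if "h \<in> {g \<in> \<Gamma>. act g p = p}" for h
      using that proj_act_eq_act[OF subgroup.mem_carrier[OF \<Gamma>] sub[OF p(1)]] by auto
    then show "\<exists>H. finite_index_subgroup H \<Gamma> PSL \<and> (\<exists>p\<in>proj_space. \<forall>h\<in>H. proj_act (proj_rep \<rho> h) p = p)"
      using finite_orbit_finite_index[OF p(2)] p(1) by blast
  qed
qed

text \<open>A finite invariant family contains the whole orbit of each member, and a finite orbit is
  itself such a family. The work lies in passing between a linear subspace and its set of projective
  points.\<close>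

lemma not_strongly_irreducible_iff:
  "\<not> strongly_irreducible (proj_rep \<rho> ` \<Gamma>) \<longleftrightarrow>
   (\<exists>W. subspace W \<and> W \<noteq> {0} \<and> W \<noteq> UNIV \<and> finite ((\<lambda>g. act g W) ` \<Gamma>))"
proof -
  define P where "P W = {p \<in> proj_space. p \<subseteq> W}" for W :: "'v set"
  have span_P: "span {v} \<in> P W" if "subspace W" "v \<in> W" "v \<noteq> 0" for v W
    using that span_minimal[of "{v}" W] by (auto simp: P_def proj_space_def)
  \<comment> \<open>The zero subspace has no points and is not recovered from them, so it must be
    kept apart.\<close>
  have Union_P: "\<Union> (P W) = W" if W: "subspace W" "W \<noteq> {0}" for W
  proof
    show "\<Union> (P W) \<subseteq> W" by (auto simp: P_def)
    obtain u where u: "u \<in> W" "u \<noteq> 0"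
      using W subspace_0[OF W(1)] by blast
    show "W \<subseteq> \<Union> (P W)"
    proof
      fix v assume "v \<in> W"
      show "v \<in> \<Union> (P W)"
      proof (cases "v = 0")
        case True
        then show ?thesis using span_P[OF W(1) u] span_zero by blast
      next
        case False
        then show ?thesis using span_P[OF W(1) \<open>v \<in> W\<close>] span_base[of v "{v}"] by blast
      qed
    qed
  qed
  have P_nonempty: "P W \<noteq> {} \<longleftrightarrow> W \<noteq> {0}" if W: "subspace W" for W
  proof
    assume "P W \<noteq> {}"
    then obtain v where "v \<noteq> 0" "span {v} \<subseteq> W" by (auto simp: P_def proj_space_def)
    then show "W \<noteq> {0}" using span_base[of v "{v}"] by blast
  next
    assume "W \<noteq> {0}"
    then show "P W \<noteq> {}" using span_P[OF W] subspace_0[OF W] by blast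
  qed
  have P_full: "P W = proj_space \<longleftrightarrow> W = UNIV" if W: "subspace W" "W \<noteq> {0}" for W
  proof
    assume "P W = proj_space"
    then have "span {v} \<subseteq> W" if "v \<noteq> 0" for v
      using that by (auto simp: P_def proj_space_def)
    then have "v \<in> W" for v
      using span_base[of v "{v}"] subspace_0[OF W(1)] by (cases "v = 0") auto
    then show "W = UNIV" by blast
  qed (auto simp: P_def)
  have act_P: "(\<lambda>p. proj_act (proj_rep \<rho> g) p) ` P W = P (act g W)" if g: "g \<in> \<Gamma>" for g W
  proof -
    interpret group "PSL :: (real^3^3) set monoid" by (rule group_PSL)
    have gc: "g \<in> carrier PSL" using subgroup.mem_carrier[OF \<Gamma> g] .
    have act_mono: "act h p \<subseteq> act h X" if "p \<subseteq> X" for h p X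
      using that by (auto simp: act_def)
    have P1: "act h p \<in> P (act h X)" if "p \<in> P X" and h: "h \<in> carrier PSL" for h p X
    proof -
      obtain v where v: "v \<noteq> 0" "p = span {v}" "p \<subseteq> X"
        using \<open>p \<in> P X\<close> by (auto simp: P_def proj_space_def)
      have "act h p = span {\<rho> (the_elem h) v}"
        using linear_span_image[OF linear, of "the_elem h" "{v}"] by (simp add: act_def v(2))
      moreover have "\<rho> (the_elem h) v \<noteq> 0"
      proof
        assume "\<rho> (the_elem h) v = 0"
        then have "act h {v} = act h {0}"
          by (simp add: act_def linear_0[OF linear])
        then have "{v} = {0}"
          using act_inv(2)[OF h] by metis
        with v(1) show False by simp
      qed
      ultimately show ?thesis
        using act_mono[OF v(3)] by (auto simp: P_def proj_space_def)
    qed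
    have "(\<lambda>p. proj_act (proj_rep \<rho> g) p) ` P W = act g ` P W"
      by (intro image_cong refl proj_act_eq_act[OF gc]) (auto simp: P_def proj_space_def)
    also have "\<dots> = P (act g W)"
    proof
      show "act g ` P W \<subseteq> P (act g W)" using P1 gc by blast
      show "P (act g W) \<subseteq> act g ` P W"
      proof
        fix p assume "p \<in> P (act g W)"
        then have "act (inv\<^bsub>PSL\<^esub> g) p \<in> P W"
          using P1[of p "act g W" "inv\<^bsub>PSL\<^esub> g"] gc by (simp add: act_inv)
        then show "p \<in> act g ` P W"
          using act_inv(1)[OF gc, of p] by (metis imageI)
      qed
    qed
    finally show ?thesis .
  qed
  show ?thesis
  proof
    assume "\<not> strongly_irreducible (proj_rep \<rho> ` \<Gamma>)"
    then obtain F where F: "finite F" "F \<noteq> {}"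
      "\<forall>S\<in>F. proj_subspace S \<and> S \<noteq> {} \<and> S \<noteq> proj_space"
      "\<forall>g\<in>proj_rep \<rho> ` \<Gamma>. (\<lambda>S. proj_act g ` S) ` F = F"
      unfolding strongly_irreducible_def by blast
    obtain S where S: "S \<in> F" using F(2) by blast
    have S_proper: "proj_subspace S" "S \<noteq> {}" "S \<noteq> proj_space"
      using F(3) S by blast+
    obtain W where W: "subspace W" "S = P W"
      using S_proper(1) unfolding proj_subspace_def P_def by blast
    have nz: "W \<noteq> {0}"
      using S_proper(2) unfolding W(2) P_nonempty[OF W(1)] .
    \<comment> \<open>Each translate of \<open>W\<close> is the union of a member of
      \<open>F\<close>, so there are only finitely many.\<close>
    have "act g W \<in> \<Union> ` F" if g: "g \<in> \<Gamma>" for g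
    proof -
      have gc: "g \<in> carrier PSL" using subgroup.mem_carrier[OF \<Gamma> g] .
      have "P (act g W) \<in> F"
      proof -
        have "(\<lambda>S. proj_act (proj_rep \<rho> g) ` S) ` F = F"
          using F(4) g by blast
        then have "proj_act (proj_rep \<rho> g) ` P W \<in> F"
          using S W(2) by blast
        then show ?thesis
          by (simp only: act_P[OF g])
      qed
      moreover have "act g W \<noteq> {0}"
      proof
        assume "act g W = {0}"
        then have "act (inv\<^bsub>PSL\<^esub> g) (act g W) = {0}"
          by (simp add: act_def linear_0[OF linear])
        then show False
          using nz by (simp add: act_inv(2)[OF gc])
      qed
      ultimately show ?thesis
        using Union_P[OF subspace_act[OF W(1), of g]] image_eqI[of "act g W" Union "P (act g W)" F]
        by simp
    qed
    then have "(\<lambda>g. act g W) ` \<Gamma> \<subseteq> \<Union> ` F" by blast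
    then have "finite ((\<lambda>g. act g W) ` \<Gamma>)"
      by (rule finite_subset) (simp add: F(1))
    then show "\<exists>W. subspace W \<and> W \<noteq> {0} \<and> W \<noteq> UNIV \<and> finite ((\<lambda>g. act g W) ` \<Gamma>)"
      using W nz S_proper(3) P_full[OF W(1) nz] by blast
  next
    assume "\<exists>W. subspace W \<and> W \<noteq> {0} \<and> W \<noteq> UNIV \<and> finite ((\<lambda>g. act g W) ` \<Gamma>)"
    then obtain W where W: "subspace W" "W \<noteq> {0}" "W \<noteq> UNIV" "finite ((\<lambda>g. act g W) ` \<Gamma>)" by blast
    interpret G: group "PSL :: (real^3^3) set monoid" by (rule group_PSL)
    define F where "F = (\<lambda>g. P (act g W)) ` \<Gamma>"
    have "finite F"
      using finite_imageI[OF W(4), of P] by (simp add: F_def image_image)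
    moreover have "F \<noteq> {}"
      using subgroup.one_closed[OF \<Gamma>] by (auto simp: F_def)
    moreover have "proj_subspace S \<and> S \<noteq> {} \<and> S \<noteq> proj_space" if "S \<in> F" for S
    proof -
      obtain g where g: "g \<in> \<Gamma>" "S = P (act g W)"
        using \<open>S \<in> F\<close> by (auto simp: F_def)
      have gc: "g \<in> carrier PSL" using subgroup.mem_carrier[OF \<Gamma> g(1)] .
      have sub: "subspace (act g W)" using subspace_act[OF W(1)] .
      have "act (inv\<^bsub>PSL\<^esub> g) {0} = {0}"
        by (simp add: act_def linear_0[OF linear])
      then have nz: "act g W \<noteq> {0}"
        using act_inv(2)[OF gc, of W] W(2) by auto
      have "act g UNIV = UNIV"
        using act_inv(1)[OF gc, of UNIV] by (auto simp: act_def)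
      then have "act (inv\<^bsub>PSL\<^esub> g) UNIV = UNIV"
        using act_inv(2)[OF gc, of UNIV] by simp
      then have "act g W \<noteq> UNIV"
        using act_inv(2)[OF gc, of W] W(3) by auto
      then show ?thesis
        using P_nonempty[OF sub] P_full[OF sub nz] nz sub g(2)
        by (auto simp: proj_subspace_def P_def)
    qed
    moreover have "(\<lambda>S. proj_act (proj_rep \<rho> g) ` S) ` F = F" if g: "g \<in> \<Gamma>" for g
    proof -
      have mem: "h \<in> carrier PSL" if "h \<in> \<Gamma>" for h
        using subgroup.mem_carrier[OF \<Gamma> that] .
      \<comment> \<open>Translation by \<open>g\<close> only reindexes the family, because left
        multiplication permutes \<Gamma>.\<close>
      have "(\<lambda>S. proj_act (proj_rep \<rho> g) ` S) ` F = (\<lambda>h. P (act (g \<otimes>\<^bsub>PSL\<^esub> h) W)) ` \<Gamma>"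
        unfolding F_def image_image act_P[OF g]
        by (intro image_cong refl) (simp add: act_mult mem g)
      also have "\<dots> = (\<lambda>h. P (act h W)) ` ((\<lambda>h. g \<otimes>\<^bsub>PSL\<^esub> h) ` \<Gamma>)"
        by (simp add: image_image)
      also have "(\<lambda>h. g \<otimes>\<^bsub>PSL\<^esub> h) ` \<Gamma> = \<Gamma>"
      proof
        show "(\<lambda>h. g \<otimes>\<^bsub>PSL\<^esub> h) ` \<Gamma> \<subseteq> \<Gamma>"
          using subgroup.m_closed[OF \<Gamma> g] by blast
        show "\<Gamma> \<subseteq> (\<lambda>h. g \<otimes>\<^bsub>PSL\<^esub> h) ` \<Gamma>"
        proof
          fix h assume h: "h \<in> \<Gamma>"
          have "h = g \<otimes>\<^bsub>PSL\<^esub> (inv\<^bsub>PSL\<^esub> g \<otimes>\<^bsub>PSL\<^esub> h)"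
            using mem[OF g] mem[OF h] by (simp flip: G.m_assoc)
          moreover have "inv\<^bsub>PSL\<^esub> g \<otimes>\<^bsub>PSL\<^esub> h \<in> \<Gamma>"
            using g h \<Gamma> by (simp add: subgroup.m_closed subgroup.m_inv_closed)
          ultimately show "h \<in> (\<lambda>h. g \<otimes>\<^bsub>PSL\<^esub> h) ` \<Gamma>" by blast
        qed
      qed
      finally show ?thesis by (simp add: F_def)
    qed
    ultimately have "\<exists>F. finite F \<and> F \<noteq> {} \<and>
      (\<forall>S\<in>F. proj_subspace S \<and> S \<noteq> {} \<and> S \<noteq> proj_space) \<and>
      (\<forall>g\<in>proj_rep \<rho> ` \<Gamma>. (\<lambda>S. proj_act g ` S) ` F = F)"
      by (intro exI[of _ F]) auto
    then show "\<not> strongly_irreducible (proj_rep \<rho> ` \<Gamma>)"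
      unfolding strongly_irreducible_def by blast
  qed
qed

end

end

section \<open>Elementary subgroups in terms of matrix groups\<close>

interpretation conic: SL3_representation form_rep
  by (intro SL3_representation.intro linear_form_rep form_rep_one form_rep_mult)

interpretation dual_conic: SL3_representation dual_form_rep
  by (intro SL3_representation.intro linear_dual_form_rep dual_form_rep_one dual_form_rep_mult)

lemma elementary_iff_finite_orbit:
  assumes "subgroup \<Gamma> PSL"
  shows "elementary \<Gamma> \<longleftrightarrow> (\<exists>p\<in>proj_space. finite ((\<lambda>g. conic.act g p) ` \<Gamma>)) \<or>
    (\<exists>p\<in>proj_space. finite ((\<lambda>g. dual_conic.act g p) ` \<Gamma>))"
  unfolding conic.virtually_fixed_point_iff[OF assms, symmetric]
    dual_conic.virtually_fixed_point_iff[OF assms, symmetric] elementary_def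
  by (simp only: conj_disj_distribL ex_disj_distrib)

lemma subgroup_SL3_of_PSL3:
  assumes "subgroup H (PSL\<lparr>carrier := \<Gamma>\<rparr>)" and "subgroup \<Gamma> PSL"
  shows "subgroup {A :: real^3^3. {A} \<in> H} SL"
proof -
  interpret G: group "PSL\<lparr>carrier := \<Gamma>\<rparr>"
    using subgroup.subgroup_is_group[OF assms(2) group_PSL] .
  interpret H: subgroup H "PSL\<lparr>carrier := \<Gamma>\<rparr>" by fact
  have H_carrier: "h \<in> (\<lambda>A. {A}) ` carrier SL" if "h \<in> H" for h
    using H.mem_carrier[OF that] subgroup.mem_carrier[OF assms(2)] by (simp flip: PSL3_carrier)
  show ?thesis
  proof (rule SL_subgroupI)
    show "mat 1 \<in> {A. {A} \<in> H}"
      using H.one_closed by (simp add: PSL3_one)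
    show "A ** B \<in> {A. {A} \<in> H}" if "A \<in> {A. {A} \<in> H}" "B \<in> {A. {A} \<in> H}" for A B
      using that H.m_closed[of "{A}" "{B}"] by (simp add: PSL3_mult)
    fix A assume A: "A \<in> {A. {A} \<in> H}"
    then show "det A = 1"
      using H_carrier[of "{A}"] by (auto simp: SL_def)
    let ?i = "inv\<^bsub>PSL\<lparr>carrier := \<Gamma>\<rparr>\<^esub> {A}"
    have i: "?i \<in> H" using A H.m_inv_closed by simp
    then obtain B where B: "?i = {B}" using H_carrier by blast
    have "{B} \<otimes>\<^bsub>PSL\<^esub> {A} = {mat 1}"
      using G.l_inv[of "{A}"] H.mem_carrier[of "{A}"] A by (simp add: B PSL3_one)
    then show "\<exists>B\<in>{A. {A} \<in> H}. B ** A = mat 1"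
      using i B by (auto simp: PSL3_mult)
  qed
qed

text \<open>Conics are moved by congruence with inverses, and \<open>G\<close> is closed under
  inverses, so the conic orbit stays within the image of the congruence orbit.\<close>

lemma finite_conic_orbit:
  assumes "subgroup G SL" and "H \<subseteq> (\<lambda>A. {A}) ` G"
    and "finite ((\<lambda>B. congr_mat B ` X) ` G)"
  shows "finite ((\<lambda>h. conic.act h (form_of_mat ` X)) ` H)"
proof -
  have "conic.act h (form_of_mat ` X) \<in> (`) form_of_mat ` (\<lambda>B. congr_mat B ` X) ` G" if "h \<in> H" for h
  proof -
    obtain A where A: "A \<in> G" "h = {A}" using assms(2) \<open>h \<in> H\<close> by blast
    have "conic.act h (form_of_mat ` X) = form_of_mat ` (congr_mat (matrix_inv A) ` X)"
      by (simp add: A(2) conic.act_singleton image_image form_rep_form_of_mat)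
    then show ?thesis
      using SL_subgroupD(3)[OF assms(1) A(1)] by blast
  qed
  then have "(\<lambda>h. conic.act h (form_of_mat ` X)) ` H \<subseteq> (`) form_of_mat ` (\<lambda>B. congr_mat B ` X) ` G"
    by blast
  then show ?thesis
    by (rule finite_subset) (intro finite_imageI assms(3))
qed

lemma finite_dual_conic_orbit:
  assumes "H \<subseteq> (\<lambda>A. {A}) ` G" and "finite ((\<lambda>B. congr_mat (transpose B) ` X) ` G)"
  shows "finite ((\<lambda>h. dual_conic.act h (dual_form_of_mat ` X)) ` H)"
proof -
  have "dual_conic.act h (dual_form_of_mat ` X) \<in> (`) dual_form_of_mat ` (\<lambda>B. congr_mat (transpose B) ` X) ` G"
    if "h \<in> H" for h
  proof -
    obtain A where A: "A \<in> G" "h = {A}" using assms(1) \<open>h \<in> H\<close> by blast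
    have "dual_conic.act h (dual_form_of_mat ` X) = dual_form_of_mat ` (congr_mat (transpose A) ` X)"
      by (simp add: A(2) dual_conic.act_singleton image_image dual_form_rep_dual_form_of_mat)
    then show ?thesis
      using A(1) by blast
  qed
  then have "(\<lambda>h. dual_conic.act h (dual_form_of_mat ` X)) ` H \<subseteq>
      (`) dual_form_of_mat ` (\<lambda>B. congr_mat (transpose B) ` X) ` G"
    by blast
  then show ?thesis
    by (rule finite_subset) (intro finite_imageI assms(2))
qed

text \<open>The stabiliser of \<open>W\<close> has finite index and corresponds to a matrix group
  with an invariant space of forms. The finite orbit found for that group remains finite on passing
  back to \<Gamma>.\<close>

lemma elementary_of_invariant_subspaces:
  assumes \<Gamma>: "subgroup \<Gamma> PSL"
    and W: "subspace W" "W \<noteq> {0}" "W \<noteq> UNIV" and orb: "finite ((\<lambda>g. conic.act g W) ` \<Gamma>)"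
  shows "elementary \<Gamma>"
proof -
  define H where "H = {g \<in> \<Gamma>. conic.act g W = W}"
  have H: "finite_index_subgroup H \<Gamma> PSL"
    unfolding H_def by (rule conic.finite_orbit_finite_index[OF \<Gamma> orb])
  define G where "G = {A. {A} \<in> H}"
  have G: "subgroup G SL"
    using subgroup_SL3_of_PSL3[of H \<Gamma>] H \<Gamma> by (simp add: G_def finite_index_subgroup_def)
  have HG: "H \<subseteq> (\<lambda>A. {A}) ` G"
  proof
    fix h assume h: "h \<in> H"
    then have "h \<in> carrier PSL" using subgroup.mem_carrier[OF \<Gamma>] by (simp add: H_def)
    then show "h \<in> (\<lambda>A. {A}) ` G" using h by (auto simp: PSL3_carrier G_def)
  qed
  obtain w where w: "w \<in> W" "w \<noteq> 0"
    using W(2) subspace_0[OF W(1)] by blast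
  obtain T where T: "transpose T = T" "w = form_of_mat T" by (rule form_of_mat_surj)
  have "\<exists>Q. transpose Q = Q \<and> Q \<noteq> 0 \<and>
    (finite ((\<lambda>B. congr_mat B ` span {Q}) ` G) \<or> finite ((\<lambda>B. congr_mat (transpose B) ` span {Q}) ` G))"
  proof (rule SL3_subgroup_invariant_subspace[OF G])
    \<comment> \<open>The preimage of \<open>W\<close> in the space of all matrices contains the
      skew matrices, as these represent the zero form.\<close>
    show "subspace (form_of_mat -` W)"
      by (rule linear_subspace_vimage[OF linear_form_of_mat W(1)])
    obtain q where "q \<notin> W" using W(3) by blast
    obtain S where "transpose S = S" "q = form_of_mat S"
      by (rule form_of_mat_surj)
    with \<open>q \<notin> W\<close> show "form_of_mat -` W \<noteq> UNIV" by blast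
    show "S \<in> form_of_mat -` W" if "transpose S = - S" for S
    proof -
      have "form_of_mat S = form_of_mat 0"
        using that by (simp add: form_of_mat_eq_iff) (simp add: transpose_def vec_eq_iff)
      then show ?thesis
        using subspace_0[OF W(1)] by (simp add: linear_0[OF linear_form_of_mat])
    qed
    show "T \<in> form_of_mat -` W" using w(1) T(2) by simp
    show "transpose T = T" by fact
    show "T \<noteq> 0" using w(2) T(2) linear_0[OF linear_form_of_mat] by auto
    show "congr_mat B S \<in> form_of_mat -` W" if B: "B \<in> G" and S: "S \<in> form_of_mat -` W" for B S
    proof -
      \<comment> \<open>Congruence by \<open>B\<close> is the action of the inverse of
        \<open>B\<close>, whence the double inverse.\<close>
      have "matrix_inv B \<in> G" "matrix_inv (matrix_inv B) = B"
      proof -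
        show B': "matrix_inv B \<in> G" using SL_subgroupD(3)[OF G B] .
        have "matrix_inv (matrix_inv B) = matrix_inv (matrix_inv B) ** (matrix_inv B ** B)"
          using SL_subgroupD(5)[OF G B] by simp
        also have "\<dots> = B"
          using SL_subgroupD(5)[OF G B'] by (simp add: matrix_mul_assoc)
        finally show "matrix_inv (matrix_inv B) = B" .
      qed
      then have "form_rep (matrix_inv B) ` W = W" "form_of_mat (congr_mat B S) = form_rep (matrix_inv B) (form_of_mat S)"
        by (simp_all add: G_def H_def conic.act_singleton form_rep_form_of_mat)
      then show ?thesis using S by auto
    qed
  qed
  then obtain Q where Q: "transpose Q = Q" "Q \<noteq> 0"
    "finite ((\<lambda>B. congr_mat B ` span {Q}) ` G) \<or> finite ((\<lambda>B. congr_mat (transpose B) ` span {Q}) ` G)"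
    by blast
  have tr0: "transpose 0 = (0 :: real^3^3)" by (simp add: transpose_def vec_eq_iff)
  from Q(3) show ?thesis
  proof
    assume "finite ((\<lambda>B. congr_mat B ` span {Q}) ` G)"
    then have "finite ((\<lambda>h. conic.act h (form_of_mat ` span {Q})) ` H)"
      by (rule finite_conic_orbit[OF G HG])
    then have "finite ((\<lambda>g. conic.act g (form_of_mat ` span {Q})) ` \<Gamma>)"
      by (rule conic.finite_index_finite_orbit[OF \<Gamma> H])
    moreover have "form_of_mat Q \<noteq> 0"
      using symmetric_form_of_mat_inject[OF Q(1) tr0] Q(2) by (simp add: linear_0[OF linear_form_of_mat])
    then have "form_of_mat ` span {Q} \<in> proj_space"
      by (auto simp: form_of_mat_image_span proj_space_def)
    ultimately show ?thesis
      by (intro iffD2[OF elementary_iff_finite_orbit[OF \<Gamma>]] disjI1 bexI)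
  next
    assume "finite ((\<lambda>B. congr_mat (transpose B) ` span {Q}) ` G)"
    then have "finite ((\<lambda>h. dual_conic.act h (dual_form_of_mat ` span {Q})) ` H)"
      by (rule finite_dual_conic_orbit[OF HG])
    then have "finite ((\<lambda>g. dual_conic.act g (dual_form_of_mat ` span {Q})) ` \<Gamma>)"
      by (rule dual_conic.finite_index_finite_orbit[OF \<Gamma> H])
    moreover have "dual_form_of_mat Q \<noteq> 0"
      using symmetric_dual_form_of_mat_inject[OF Q(1) tr0] Q(2) by (simp add: linear_0[OF linear_dual_form_of_mat])
    then have "dual_form_of_mat ` span {Q} \<in> proj_space"
      by (auto simp: dual_form_of_mat_image_span proj_space_def)
    ultimately show ?thesis
      by (intro iffD2[OF elementary_iff_finite_orbit[OF \<Gamma>]] disjI2 bexI)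
  qed
qed

section \<open>Non-elementary and strongly irreducible subgroups\<close>

theorem theoremB3:
  fixes \<Gamma> :: "(real^3^3) set set"
  assumes "subgroup \<Gamma> PSL"
  shows "\<not> elementary \<Gamma> \<longleftrightarrow> strongly_irreducible (conic_rep ` \<Gamma>)"
proof -
  have "\<exists>W. subspace W \<and> W \<noteq> {0} \<and> W \<noteq> UNIV \<and> finite ((\<lambda>g. conic.act g W) ` \<Gamma>)"
    if "elementary \<Gamma>"
    using that unfolding elementary_iff_finite_orbit[OF assms]
  proof
    assume "\<exists>p\<in>proj_space. finite ((\<lambda>g. conic.act g p) ` \<Gamma>)"
    then obtain p where p: "p \<in> proj_space" "finite ((\<lambda>g. conic.act g p) ` \<Gamma>)" by blast
    \<comment> \<open>A conic with finite orbit is already a suitable one-dimensional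
      subspace.\<close>
    then have "subspace p" by (auto simp: proj_space_def)
    then show ?thesis
      using conic_point_proper[OF p(1)] p(2) by (intro exI[of _ p] conjI)
  next
    assume "\<exists>p\<in>proj_space. finite ((\<lambda>g. dual_conic.act g p) ` \<Gamma>)"
    then obtain p where p: "p \<in> proj_space" "finite ((\<lambda>g. dual_conic.act g p) ` \<Gamma>)" by blast
    \<comment> \<open>For a dual conic the suitable subspace is the hyperplane of conics apolar to
      it; equivariance of \<open>apolar\<close> keeps its orbit finite.\<close>
    have "conic.act g (apolar p) = apolar (dual_conic.act g p)" if "g \<in> \<Gamma>" for g
    proof -
      have "g \<in> (\<lambda>A. {A}) ` carrier SL"
        using subgroup.mem_carrier[OF assms that] by (simp add: PSL3_carrier)
      then show ?thesis
        by (auto simp: conic.act_singleton dual_conic.act_singleton form_rep_image_apolar)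
    qed
    then have "(\<lambda>g. conic.act g (apolar p)) ` \<Gamma> = apolar ` (\<lambda>g. dual_conic.act g p) ` \<Gamma>"
      by (simp add: image_image)
    then have "finite ((\<lambda>g. conic.act g (apolar p)) ` \<Gamma>)"
      using p(2) by simp
    then show ?thesis
      using subspace_apolar[of p] apolar_proper[OF p(1)] by (intro exI[of _ "apolar p"] conjI)
  qed
  moreover have "elementary \<Gamma>"
    if "\<exists>W. subspace W \<and> W \<noteq> {0} \<and> W \<noteq> UNIV \<and> finite ((\<lambda>g. conic.act g W) ` \<Gamma>)"
    using that by (elim exE conjE) (rule elementary_of_invariant_subspaces[OF assms])
  ultimately have "elementary \<Gamma> \<longleftrightarrow> \<not> strongly_irreducible (conic_rep ` \<Gamma>)"
    unfolding conic.not_strongly_irreducible_iff[OF assms] by (rule iffI)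
  then show ?thesis
    by simp
qed

end
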